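(* Let $0\le\gamma<1$, let $a\in\mathbb{R}$ and let $b_j\in\mathbb{R}$ $(j\ge1)$. Let $Q:\mathbb{R}\to\mathbb{R}$ satisfy $|Q(x)-Q(y)|\le\mathrm{Lip}_Q|x-y|$ for all $x,y\in\mathbb{R}$, where $\mathrm{Lip}_Q>0$. Let $p\in\{2,4,6,\dots\}$ be even, and let $\{\zeta_t,t\in\mathbb{Z}\}$ be an i.i.d. sequence with $\mathrm{E}|\zeta_0|^p<\infty$ and $\mathrm{E}\zeta_0=0$; put $\mu_j:=\mathrm{E}\zeta_0^j$, $2\le j\le p$. Suppose that $$\sum_{j=2}^p\binom{p}{j}|\mu_j|\,\mathrm{Lip}_Q^j\sum_{k=1}^\infty|b_k|^j<(1-\gamma)^{p/2}.$$ Then there exists a unique stationary $L^p$-solution $\{X_t\}$ of the equation $$X_t=\sum_{s<t}b_{t-s}\,\zeta_s\sqrt{\sum_{\ell=0}^\infty\gamma^\ell Q^2(a+X_{s-\ell})},\qquad t\in\mathbb{Z}.\qquad( * )$$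
   Context: Let $\mathcal{F}_t=\sigma(\zeta_s,s\le t)$. A process $\{u_t\}$ is predictable if $u_t$ is $\mathcal{F}_{t-1}$-measurable for each $t\in\mathbb{Z}$. An $L^p$-solution of $( * )$ is a predictable process $\{X_t,t\in\mathbb{Z}\}$ with $\mathrm{E}|X_t|^p<\infty$ such that for every $t\in\mathbb{Z}$ the series $\sigma_t^2=\sum_{\ell=0}^\infty\gamma^\ell Q^2(a+X_{t-\ell})$ converges in $L^{p/2}$, the series $\sum_{s<t}b_{t-s}\zeta_s\sigma_s$ converges in $L^p$ (where $\sigma_s=\sqrt{\sigma_s^2}$), and $( * )$ holds. Stationary means strictly stationary. *)

theory Defs
  imports "HOL-Probability.Probability"
begin

definition in_Lp :: "'w measure \<Rightarrow> nat \<Rightarrow> ('w \<Rightarrow> real) \<Rightarrow> bool" where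
  "in_Lp M q f \<longleftrightarrow> f \<in> borel_measurable M \<and> integrable M (\<lambda>\<omega>. \<bar>f \<omega>\<bar> ^ q)"

definition tendsto_Lp ::
  "'w measure \<Rightarrow> nat \<Rightarrow> (nat \<Rightarrow> 'w \<Rightarrow> real) \<Rightarrow> ('w \<Rightarrow> real) \<Rightarrow> bool" where
  "tendsto_Lp M q F f \<longleftrightarrow>
     (\<forall>n. in_Lp M q (F n)) \<and> in_Lp M q f \<and>
     (\<lambda>n. \<integral>\<omega>. \<bar>F n \<omega> - f \<omega>\<bar> ^ q \<partial>M) \<longlonglongrightarrow> 0"

definition iid :: "'w measure \<Rightarrow> (int \<Rightarrow> 'w \<Rightarrow> real) \<Rightarrow> bool" where
  "iid M \<zeta> \<longleftrightarrow> prob_space.indep_vars M (\<lambda>_. borel) \<zeta> UNIV \<and>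
     (\<forall>s t. distr M borel (\<zeta> s) = distr M borel (\<zeta> t))"

text \<open>The sigma-algebra generated by \<open>\<zeta> s\<close>, \<open>s \<le> t\<close>; it is not completed by null sets.\<close>

definition past :: "'w measure \<Rightarrow> (int \<Rightarrow> 'w \<Rightarrow> real) \<Rightarrow> int \<Rightarrow> 'w measure" where
  "past M \<zeta> t = sigma (space M) {\<zeta> s -` A \<inter> space M | s A. s \<le> t \<and> A \<in> sets borel}"

definition predictable ::
  "'w measure \<Rightarrow> (int \<Rightarrow> 'w \<Rightarrow> real) \<Rightarrow> (int \<Rightarrow> 'w \<Rightarrow> real) \<Rightarrow> bool" where
  "predictable M \<zeta> u \<longleftrightarrow> (\<forall>t. u t \<in> borel_measurable (past M \<zeta> (t - 1)))"

text \<open>Strict stationarity: shifting time leaves all finite-dimensional distributions unchanged.\<close>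

definition stationary :: "'w measure \<Rightarrow> (int \<Rightarrow> 'w \<Rightarrow> real) \<Rightarrow> bool" where
  "stationary M X \<longleftrightarrow> (\<forall>t. X t \<in> borel_measurable M) \<and>
     (\<forall>I h. finite I \<longrightarrow>
        distr M (\<Pi>\<^sub>M i\<in>I. borel) (\<lambda>\<omega>. \<lambda>i\<in>I. X (i + h) \<omega>) =
        distr M (\<Pi>\<^sub>M i\<in>I. borel) (\<lambda>\<omega>. \<lambda>i\<in>I. X i \<omega>))"

text \<open>The squared volatility is the pointwise sum of a nonnegative series. Where that series
  diverges, \<^const>\<open>suminf\<close> has no meaning, but the convergence required of a solution
  below confines this to a null set: an \<open>L\<^sup>q\<close>-limit of increasing partial sums is also their
  almost sure limit.\<close>

definition vol2 ::
  "real \<Rightarrow> (real \<Rightarrow> real) \<Rightarrow> real \<Rightarrow> (int \<Rightarrow> 'w \<Rightarrow> real) \<Rightarrow> int \<Rightarrow> 'w \<Rightarrow> real" where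
  "vol2 \<gamma> Q a X t \<omega> = (\<Sum>l. \<gamma> ^ l * (Q (a + X (t - int l) \<omega>))\<^sup>2)"

text \<open>The exponent \<open>p\<close> is even, so \<open>p div 2\<close> is \<open>p/2\<close>. The last clause states both that the
  series over \<open>s < t\<close> (summed backwards from \<open>t - 1\<close>) converges in \<open>L\<^sup>p\<close> and
  that its sum is \<open>X t\<close>, almost surely. The value \<open>b 0\<close> is never used.\<close>

definition Lp_solution ::
  "'w measure \<Rightarrow> (int \<Rightarrow> 'w \<Rightarrow> real) \<Rightarrow> nat \<Rightarrow> real \<Rightarrow> (real \<Rightarrow> real) \<Rightarrow> real \<Rightarrow> (nat \<Rightarrow> real)
     \<Rightarrow> (int \<Rightarrow> 'w \<Rightarrow> real) \<Rightarrow> bool" where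
  "Lp_solution M \<zeta> p \<gamma> Q a b X \<longleftrightarrow>
     predictable M \<zeta> X \<and>
     (\<forall>t. integrable M (\<lambda>\<omega>. \<bar>X t \<omega>\<bar> ^ p)) \<and>
     (\<forall>t. tendsto_Lp M (p div 2)
            (\<lambda>n \<omega>. \<Sum>l<n. \<gamma> ^ l * (Q (a + X (t - int l) \<omega>))\<^sup>2) (vol2 \<gamma> Q a X t)) \<and>
     (\<forall>t. tendsto_Lp M p
            (\<lambda>n \<omega>. \<Sum>s\<in>{t - int n..<t}. b (nat (t - s)) * \<zeta> s \<omega> * sqrt (vol2 \<gamma> Q a X s \<omega>)) (X t))"

end

theory Submission
  imports Defs
begin

text \<open>The map sending a predictable process \<open>X\<close> to the right-hand side of the equation contracts
  \<open>sup\<^sub>t \<parallel>X\<^sub>t\<parallel>\<^sub>p\<close>. If \<open>\<parallel>X\<^sub>t - Y\<^sub>t\<parallel>\<^sub>p \<le> C\<close> for all \<open>t\<close>, then the volatilities differ by at most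
  \<open>V C\<close>, where \<open>V = Lip / sqrt (1 - \<gamma>)\<close>, by the triangle inequalities in a weighted \<open>\<ell>\<^sup>2\<close> and in
  \<open>L\<^bsup>p/2\<^esup>\<close>. Let \<open>u\<^sub>s\<close> be the difference of the volatilities. Expanding the \<open>p\<close>-th power of the
  partial sums \<open>S\<close> of the martingale \<open>\<Sum> b\<^bsub>t-s\<^esub> \<zeta>\<^sub>s u\<^sub>s\<close>, adding one term at a time in increasing \<open>s\<close>, the
  first-order term vanishes and the \<open>j\<close>-th one involves \<open>E (u\<^sub>s\<^sup>j S\<^bsup>p-j\<^esup>)\<close>. Young's inequality bounds
  this by \<open>C\<^sup>p\<close> (up to the factor \<open>V\<^sup>j\<close>) as long as \<open>E S\<^sup>p \<le> C\<^sup>p\<close>, and the moment condition implies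
  that the increments then add up to at most \<open>K C\<^sup>p\<close> with \<open>K < 1\<close>, which keeps the induction going.

  For existence the contraction is iterated on processes \<open>X\<^sub>t = g (\<zeta>\<^bsub>t-1\<^esub>, \<zeta>\<^bsub>t-2\<^esub>, \<dots>)\<close> with one measurable
  functional \<open>g\<close>, an element of \<open>L\<^sup>p\<close> of the law of the noise; these are predictable and stationary
  by construction. For uniqueness, stationarity makes \<open>sup\<^sub>t \<parallel>X\<^sub>t\<parallel>\<^sub>p\<close> finite.\<close>

subsection \<open>The \<open>L\<^sup>q\<close> norm\<close>

lemma convex_on_power_nonneg: "convex_on {0::real..} (\<lambda>x. x ^ n)"
  using convex_power_even[of n] convex_power_odd[of n] convex_on_subset by (cases "even n") blast+

text \<open>Convexity of the \<open>q\<close>-th power: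
  \<open>(\<bar>x\<bar> + \<bar>y\<bar>) / (A + B)\<close> is the average of
  \<open>\<bar>x\<bar> / A\<close> and \<open>\<bar>y\<bar> / B\<close> with weights
  \<open>A / (A + B)\<close> and \<open>B / (A + B)\<close>. The weights stay free because
  Minkowski's inequality takes \<open>A\<close> and \<open>B\<close> close to the norms.\<close>

lemma power_abs_add_le:
  fixes x y A B :: real
  assumes "A > 0" "B > 0" "q \<ge> 1"
  shows "\<bar>x + y\<bar> ^ q \<le> (A + B) ^ (q - 1) * (\<bar>x\<bar> ^ q / A ^ (q - 1) + \<bar>y\<bar> ^ q / B ^ (q - 1))"
proof -
  have pow: "z ^ q = z * z ^ (q - 1)" for z :: real
    using \<open>q \<ge> 1\<close> by (simp flip: power_Suc)
  have "(\<bar>x\<bar> + \<bar>y\<bar>) / (A + B) = (A / (A + B)) * (\<bar>x\<bar> / A) + (B / (A + B)) * (\<bar>y\<bar> / B)"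
    using assms by (simp add: add_divide_distrib)
  then have "((\<bar>x\<bar> + \<bar>y\<bar>) / (A + B)) ^ q \<le> A / (A + B) * (\<bar>x\<bar> / A) ^ q + B / (A + B) * (\<bar>y\<bar> / B) ^ q"
    using convex_onD[OF convex_on_power_nonneg[of q], of "B / (A + B)" "\<bar>x\<bar> / A" "\<bar>y\<bar> / B"] assms
    by (simp add: divide_simps)
  then have "(\<bar>x\<bar> + \<bar>y\<bar>) ^ q
      \<le> (A + B) ^ q * (A / (A + B) * (\<bar>x\<bar> / A) ^ q + B / (A + B) * (\<bar>y\<bar> / B) ^ q)"
    using assms by (simp add: power_divide pos_divide_le_eq mult.commute)
  also have "\<dots> = (A + B) ^ (q - 1) * (\<bar>x\<bar> ^ q / A ^ (q - 1) + \<bar>y\<bar> ^ q / B ^ (q - 1))"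
  proof -
    have "(A + B) ^ q * (A / (A + B) * (\<bar>x\<bar> / A) ^ q) = (A + B) ^ (q - 1) * (\<bar>x\<bar> ^ q / A ^ (q - 1))"
      "(A + B) ^ q * (B / (A + B) * (\<bar>y\<bar> / B) ^ q) = (A + B) ^ (q - 1) * (\<bar>y\<bar> ^ q / B ^ (q - 1))"
      using assms by (simp_all add: pow[of "A + B"] power_divide pow[of A] pow[of B])
    then show ?thesis by (simp only: distrib_left)
  qed
  finally show ?thesis
    by (meson abs_ge_zero abs_triangle_ineq order_trans power_mono)
qed

lemma in_Lp_add:
  assumes "in_Lp M q f" "in_Lp M q g" "q \<ge> 1"
  shows "in_Lp M q (\<lambda>\<omega>. f \<omega> + g \<omega>)"
proof -
  have [measurable]: "f \<in> borel_measurable M" "g \<in> borel_measurable M"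
    using assms by (auto simp: in_Lp_def)
  have "integrable M (\<lambda>\<omega>. \<bar>f \<omega> + g \<omega>\<bar> ^ q)"
  proof (rule Bochner_Integration.integrable_bound)
    show "integrable M (\<lambda>\<omega>. 2 ^ (q - 1) * (\<bar>f \<omega>\<bar> ^ q + \<bar>g \<omega>\<bar> ^ q))"
      using assms by (auto simp: in_Lp_def)
    show "AE \<omega> in M. norm (\<bar>f \<omega> + g \<omega>\<bar> ^ q) \<le> norm (2 ^ (q - 1) * (\<bar>f \<omega>\<bar> ^ q + \<bar>g \<omega>\<bar> ^ q))"
      using power_abs_add_le[of 1 1 q "f _" "g _"] \<open>q \<ge> 1\<close> by (auto simp: abs_mult)
  qed simp
  then show ?thesis by (simp add: in_Lp_def)
qed

lemma in_Lp_uminus: "in_Lp M q f \<Longrightarrow> in_Lp M q (\<lambda>\<omega>. - f \<omega>)"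
  by (simp add: in_Lp_def)

lemma in_Lp_diff:
  assumes "in_Lp M q f" "in_Lp M q g" "q \<ge> 1"
  shows "in_Lp M q (\<lambda>\<omega>. f \<omega> - g \<omega>)"
  using in_Lp_add[OF assms(1) in_Lp_uminus[OF assms(2)] assms(3)] by simp

lemma in_Lp_zero: "q \<ge> 1 \<Longrightarrow> in_Lp M q (\<lambda>_. 0)"
  by (simp add: in_Lp_def power_0_left)

lemma in_Lp_cmult: "in_Lp M q f \<Longrightarrow> in_Lp M q (\<lambda>\<omega>. c * f \<omega>)"
  by (auto simp: in_Lp_def abs_mult power_mult_distrib)

text \<open>The integral of a non-integrable function is 0 by convention, so a bound on this norm is
  informative only together with \<open>in_Lp\<close>.\<close>

definition Lnorm :: "'w measure \<Rightarrow> nat \<Rightarrow> ('w \<Rightarrow> real) \<Rightarrow> real" where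
  "Lnorm M q f = root q (\<integral>\<omega>. \<bar>f \<omega>\<bar> ^ q \<partial>M)"

lemma Lnorm_nonneg [simp]: "0 \<le> Lnorm M q f"
  by (cases "q = 0") (auto simp: Lnorm_def)

lemma Lnorm_power: "q \<ge> 1 \<Longrightarrow> Lnorm M q f ^ q = (\<integral>\<omega>. \<bar>f \<omega>\<bar> ^ q \<partial>M)"
  by (simp add: Lnorm_def)

lemma Lnorm_le_iff: "q \<ge> 1 \<Longrightarrow> 0 \<le> C \<Longrightarrow> Lnorm M q f \<le> C \<longleftrightarrow> (\<integral>\<omega>. \<bar>f \<omega>\<bar> ^ q \<partial>M) \<le> C ^ q"
  by (metis Lnorm_nonneg Lnorm_power power_mono_iff not_one_le_zero not_gr_zero)

lemma Lnorm_leD: "q \<ge> 1 \<Longrightarrow> Lnorm M q f \<le> C \<Longrightarrow> (\<integral>\<omega>. \<bar>f \<omega>\<bar> ^ q \<partial>M) \<le> C ^ q"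
  using Lnorm_le_iff order_trans[OF Lnorm_nonneg] by blast

lemma Lnorm_zero: "q \<ge> 1 \<Longrightarrow> Lnorm M q (\<lambda>_. 0) = 0"
  by (simp add: Lnorm_def)

lemma Lnorm_uminus: "Lnorm M q (\<lambda>\<omega>. - f \<omega>) = Lnorm M q f"
  by (simp add: Lnorm_def)

lemma Lnorm_minus_commute: "Lnorm M q (\<lambda>\<omega>. f \<omega> - g \<omega>) = Lnorm M q (\<lambda>\<omega>. g \<omega> - f \<omega>)"
  by (simp add: Lnorm_def abs_minus_commute)

lemma Lnorm_cmult: "q \<ge> 1 \<Longrightarrow> Lnorm M q (\<lambda>\<omega>. c * f \<omega>) = \<bar>c\<bar> * Lnorm M q f"
  by (simp add: Lnorm_def abs_mult power_mult_distrib real_root_mult real_root_power_cancel)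

lemma Lnorm_cong_AE:
  assumes "f \<in> borel_measurable M" "g \<in> borel_measurable M" "AE \<omega> in M. f \<omega> = g \<omega>"
  shows "Lnorm M q f = Lnorm M q g"
  unfolding Lnorm_def using assms by (intro arg_cong[where f = "root q"] integral_cong_AE) auto

text \<open>Minkowski's inequality: with \<open>A\<close> and \<open>B\<close> just above the two
  norms, the integrated convexity bound is at most \<open>(A + B) ^ q\<close>.\<close>

lemma Lnorm_add_le:
  assumes f: "in_Lp M q f" and g: "in_Lp M q g" and q: "q \<ge> 1"
  shows "Lnorm M q (\<lambda>\<omega>. f \<omega> + g \<omega>) \<le> Lnorm M q f + Lnorm M q g"
proof (rule field_le_epsilon)
  fix e :: real assume "e > 0"
  \<comment> \<open>The summand \<open>e / 2\<close> keeps both weights positive even if a norm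
    vanishes.\<close>
  define A B where "A = Lnorm M q f + e / 2" and "B = Lnorm M q g + e / 2"
  have pos: "A > 0" "B > 0"
    using \<open>e > 0\<close> by (auto simp: A_def B_def add_nonneg_pos)
  have fA: "(\<integral>\<omega>. \<bar>f \<omega>\<bar> ^ q \<partial>M) \<le> A ^ q" and gB: "(\<integral>\<omega>. \<bar>g \<omega>\<bar> ^ q \<partial>M) \<le> B ^ q"
    using Lnorm_le_iff[OF q, of A M f] Lnorm_le_iff[OF q, of B M g] pos \<open>e > 0\<close>
    by (simp_all add: A_def B_def)
  have pow: "z ^ q = z * z ^ (q - 1)" for z :: real
    using q by (simp flip: power_Suc)
  have "(\<integral>\<omega>. \<bar>f \<omega> + g \<omega>\<bar> ^ q \<partial>M)
      \<le> (\<integral>\<omega>. (A + B) ^ (q - 1) * (\<bar>f \<omega>\<bar> ^ q / A ^ (q - 1) + \<bar>g \<omega>\<bar> ^ q / B ^ (q - 1)) \<partial>M)"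
    using in_Lp_add[OF f g q] f g pos q
    by (intro integral_mono power_abs_add_le) (auto simp: in_Lp_def)
  also have "\<dots> = (A + B) ^ (q - 1) * ((\<integral>\<omega>. \<bar>f \<omega>\<bar> ^ q \<partial>M) / A ^ (q - 1) + (\<integral>\<omega>. \<bar>g \<omega>\<bar> ^ q \<partial>M) / B ^ (q - 1))"
    using f g by (simp add: in_Lp_def)
  also have "\<dots> \<le> (A + B) ^ (q - 1) * (A ^ q / A ^ (q - 1) + B ^ q / B ^ (q - 1))"
    using pos fA gB by (intro mult_left_mono add_mono divide_right_mono) auto
  also have "\<dots> = (A + B) ^ q"
    using pos by (simp add: pow[of A] pow[of B] pow[of "A + B"] mult.commute)
  finally have "Lnorm M q (\<lambda>\<omega>. f \<omega> + g \<omega>) \<le> A + B"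
    using pos by (subst Lnorm_le_iff[OF q]) auto
  then show "Lnorm M q (\<lambda>\<omega>. f \<omega> + g \<omega>) \<le> Lnorm M q f + Lnorm M q g + e"
    by (simp add: A_def B_def)
qed

lemma Lnorm_diff_triangle:
  assumes "in_Lp M q f" "in_Lp M q g" "in_Lp M q h" "q \<ge> 1"
  shows "Lnorm M q (\<lambda>\<omega>. f \<omega> - h \<omega>) \<le> Lnorm M q (\<lambda>\<omega>. f \<omega> - g \<omega>) + Lnorm M q (\<lambda>\<omega>. g \<omega> - h \<omega>)"
  using Lnorm_add_le[OF in_Lp_diff[OF assms(1,2,4)] in_Lp_diff[OF assms(2,3,4)] assms(4)] by simp

lemma Lnorm_eq_0_imp_AE:
  assumes "in_Lp M q f" "q \<ge> 1" "Lnorm M q f = 0"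
  shows "AE \<omega> in M. f \<omega> = 0"
proof -
  have "(\<integral>\<omega>. \<bar>f \<omega>\<bar> ^ q \<partial>M) = 0"
    using Lnorm_power[of q M f] assms(2,3) by (simp add: power_0_left)
  then have "AE \<omega> in M. \<bar>f \<omega>\<bar> ^ q = 0"
    using assms integral_nonneg_eq_0_iff_AE[of M "\<lambda>\<omega>. \<bar>f \<omega>\<bar> ^ q"] by (simp add: in_Lp_def)
  then show ?thesis
    by (rule AE_mp) auto
qed

lemma tendsto_Lp_iff_Lnorm:
  assumes "q \<ge> 1"
  shows "tendsto_Lp M q F f \<longleftrightarrow>
    (\<forall>n. in_Lp M q (F n)) \<and> in_Lp M q f \<and> (\<lambda>n. Lnorm M q (\<lambda>\<omega>. F n \<omega> - f \<omega>)) \<longlonglongrightarrow> 0"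
proof -
  have "(\<lambda>n. \<integral>\<omega>. \<bar>F n \<omega> - f \<omega>\<bar> ^ q \<partial>M) \<longlonglongrightarrow> 0 \<longleftrightarrow> (\<lambda>n. Lnorm M q (\<lambda>\<omega>. F n \<omega> - f \<omega>)) \<longlonglongrightarrow> 0"
  proof
    assume "(\<lambda>n. \<integral>\<omega>. \<bar>F n \<omega> - f \<omega>\<bar> ^ q \<partial>M) \<longlonglongrightarrow> 0"
    from tendsto_real_root[OF this, of q] show "(\<lambda>n. Lnorm M q (\<lambda>\<omega>. F n \<omega> - f \<omega>)) \<longlonglongrightarrow> 0"
      by (simp add: Lnorm_def)
  next
    assume "(\<lambda>n. Lnorm M q (\<lambda>\<omega>. F n \<omega> - f \<omega>)) \<longlonglongrightarrow> 0"
    from tendsto_power[OF this, of q] show "(\<lambda>n. \<integral>\<omega>. \<bar>F n \<omega> - f \<omega>\<bar> ^ q \<partial>M) \<longlonglongrightarrow> 0"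
      using assms by (simp add: Lnorm_power power_0_left)
  qed
  then show ?thesis by (simp add: tendsto_Lp_def)
qed

lemma tendsto_Lp_diff:
  assumes F: "tendsto_Lp M q F f" and G: "tendsto_Lp M q G g" and q: "q \<ge> 1"
  shows "tendsto_Lp M q (\<lambda>n \<omega>. F n \<omega> - G n \<omega>) (\<lambda>\<omega>. f \<omega> - g \<omega>)"
proof -
  note F' = F[unfolded tendsto_Lp_iff_Lnorm[OF q]] and G' = G[unfolded tendsto_Lp_iff_Lnorm[OF q]]
  have "Lnorm M q (\<lambda>\<omega>. (F n \<omega> - G n \<omega>) - (f \<omega> - g \<omega>))
      \<le> Lnorm M q (\<lambda>\<omega>. F n \<omega> - f \<omega>) + Lnorm M q (\<lambda>\<omega>. G n \<omega> - g \<omega>)" for n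
    using Lnorm_add_le[of M q "\<lambda>\<omega>. F n \<omega> - f \<omega>" "\<lambda>\<omega>. g \<omega> - G n \<omega>"] F' G' q
    by (simp add: in_Lp_diff algebra_simps Lnorm_minus_commute[of M q "G n" g])
  moreover have "(\<lambda>n. Lnorm M q (\<lambda>\<omega>. F n \<omega> - f \<omega>) + Lnorm M q (\<lambda>\<omega>. G n \<omega> - g \<omega>)) \<longlonglongrightarrow> 0"
    using F' G' by (auto intro: tendsto_add_zero)
  ultimately have "(\<lambda>n. Lnorm M q (\<lambda>\<omega>. (F n \<omega> - G n \<omega>) - (f \<omega> - g \<omega>))) \<longlonglongrightarrow> 0"
    by (rule_tac tendsto_sandwich[of "\<lambda>_. 0"]) auto
  then show ?thesis
    unfolding tendsto_Lp_iff_Lnorm[OF q] using F' G' q by (auto intro: in_Lp_diff)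
qed

lemma tendsto_Lp_Lnorm_le:
  assumes F: "tendsto_Lp M q F f" and q: "q \<ge> 1" and le: "\<And>n. Lnorm M q (F n) \<le> C"
  shows "Lnorm M q f \<le> C"
proof -
  note F' = F[unfolded tendsto_Lp_iff_Lnorm[OF q]]
  have "Lnorm M q f \<le> C + Lnorm M q (\<lambda>\<omega>. F n \<omega> - f \<omega>)" for n
    using Lnorm_add_le[of M q "F n" "\<lambda>\<omega>. f \<omega> - F n \<omega>"] F' q le[of n]
    by (simp add: in_Lp_diff Lnorm_minus_commute[of M q "F n" f])
  moreover have "(\<lambda>n. C + Lnorm M q (\<lambda>\<omega>. F n \<omega> - f \<omega>)) \<longlonglongrightarrow> C + 0"
    using F' by (intro tendsto_intros) auto
  ultimately show ?thesis
    by (intro LIMSEQ_le_const[of _ "C"]) auto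
qed

text \<open>Allows a change of version of the limit; the fixed point in the existence proof
  satisfies its equation only almost surely.\<close>

lemma tendsto_Lp_cong_AE:
  assumes F: "tendsto_Lp M q F f" and eq: "AE \<omega> in M. f \<omega> = g \<omega>" and [measurable]: "g \<in> borel_measurable M"
  shows "tendsto_Lp M q F g"
proof -
  have [measurable]: "f \<in> borel_measurable M" "F n \<in> borel_measurable M" for n
    using F by (auto simp: tendsto_Lp_def in_Lp_def)
  have "(\<integral>\<omega>. \<bar>F n \<omega> - f \<omega>\<bar> ^ q \<partial>M) = (\<integral>\<omega>. \<bar>F n \<omega> - g \<omega>\<bar> ^ q \<partial>M)" for n
    using eq by (intro integral_cong_AE) auto
  moreover have "integrable M (\<lambda>\<omega>. \<bar>f \<omega>\<bar> ^ q) \<longleftrightarrow> integrable M (\<lambda>\<omega>. \<bar>g \<omega>\<bar> ^ q)"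
    using eq by (intro integrable_cong_AE) auto
  ultimately show ?thesis
    using F by (simp add: tendsto_Lp_def in_Lp_def)
qed

text \<open>Pulls convergence back from the law of \<open>W\<close>, so that one limit constructed
  on the law of the noise serves at every time.\<close>

lemma tendsto_Lp_distr:
  assumes [measurable]: "W \<in> measurable M P"
    and "tendsto_Lp (distr M P W) q F f"
  shows "tendsto_Lp M q (\<lambda>n \<omega>. F n (W \<omega>)) (\<lambda>\<omega>. f (W \<omega>))"
proof -
  have [measurable]: "f \<in> borel_measurable P" "F n \<in> borel_measurable P" for n
    using assms by (auto simp: tendsto_Lp_def in_Lp_def)
  show ?thesis
    using assms(2) by (simp add: tendsto_Lp_def in_Lp_def integrable_distr_eq integral_distr)
qed

lemma in_Lp_distr_iff:
  assumes "W \<in> measurable M P" "f \<in> borel_measurable P"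
  shows "in_Lp (distr M P W) q f \<longleftrightarrow> in_Lp M q (\<lambda>\<omega>. f (W \<omega>))"
  using assms by (simp add: in_Lp_def integrable_distr_eq measurable_compose[OF assms])

lemma Lnorm_distr:
  assumes "W \<in> measurable M P" "f \<in> borel_measurable P"
  shows "Lnorm (distr M P W) q f = Lnorm M q (\<lambda>\<omega>. f (W \<omega>))"
  using assms by (simp add: Lnorm_def integral_distr)

text \<open>Lets \<open>L\<^sup>q\<close> estimates bound first moments without Hoelder's inequality; applied with
  \<open>d = 2\<^sup>-\<^sup>k\<close> in the completeness proof.\<close>

lemma abs_le_add_power:
  fixes x d :: real
  assumes "d > 0" "q \<ge> 1"
  shows "\<bar>x\<bar> \<le> d + \<bar>x\<bar> ^ q / d ^ (q - 1)"
proof (cases "\<bar>x\<bar> \<le> d")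
  case True
  then show ?thesis using assms by (simp add: add_increasing2)
next
  case False
  have "1 \<le> (\<bar>x\<bar> / d) ^ (q - 1)"
    using False assms by (intro one_le_power) auto
  then have "\<bar>x\<bar> * 1 \<le> \<bar>x\<bar> * (\<bar>x\<bar> / d) ^ (q - 1)"
    by (intro mult_left_mono) auto
  also have "\<dots> = \<bar>x\<bar> ^ q / d ^ (q - 1)"
    using assms power_Suc[of "\<bar>x\<bar>" "q - 1"] by (simp add: power_divide del: power_Suc)
  finally show ?thesis using assms by simp
qed

section \<open>Domination, finite sums, squares, almost sure limits and completeness\<close>

lemma Lnorm_mono:
  assumes g: "in_Lp M q g" and f [measurable]: "f \<in> borel_measurable M" and q: "q \<ge> 1"
    and le: "AE \<omega> in M. \<bar>f \<omega>\<bar> \<le> \<bar>g \<omega>\<bar>"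
  shows "in_Lp M q f" and "Lnorm M q f \<le> Lnorm M q g"
proof -
  have [measurable]: "g \<in> borel_measurable M"
    using g by (auto simp: in_Lp_def)
  have le': "AE \<omega> in M. \<bar>f \<omega>\<bar> ^ q \<le> \<bar>g \<omega>\<bar> ^ q"
    using le by eventually_elim (rule power_mono, auto)
  have g': "integrable M (\<lambda>\<omega>. \<bar>g \<omega>\<bar> ^ q)"
    using g by (simp add: in_Lp_def)
  have int: "integrable M (\<lambda>\<omega>. \<bar>f \<omega>\<bar> ^ q)"
    by (rule Bochner_Integration.integrable_bound[OF g']) (use le' in auto)
  then show "in_Lp M q f"
    by (simp add: in_Lp_def)
  have "(\<integral>\<omega>. \<bar>f \<omega>\<bar> ^ q \<partial>M) \<le> (\<integral>\<omega>. \<bar>g \<omega>\<bar> ^ q \<partial>M)"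
    by (rule integral_mono_AE[OF int g' le'])
  then show "Lnorm M q f \<le> Lnorm M q g"
    using q by (simp add: Lnorm_def)
qed

lemma (in prob_space) in_Lp_const: "in_Lp M q (\<lambda>_. c)"
  by (simp add: in_Lp_def)

lemma (in prob_space) Lnorm_const: "q \<ge> 1 \<Longrightarrow> Lnorm M q (\<lambda>_. c) = \<bar>c\<bar>"
  by (simp add: Lnorm_def prob_space real_root_power_cancel)

lemma in_Lp_sum:
  assumes "finite I" "\<And>i. i \<in> I \<Longrightarrow> in_Lp M q (f i)" "q \<ge> 1"
  shows "in_Lp M q (\<lambda>\<omega>. \<Sum>i\<in>I. f i \<omega>)"
  using assms by (induction I rule: finite_induct) (auto intro: in_Lp_add in_Lp_zero)

lemma Lnorm_sum_le:
  assumes "finite I" "\<And>i. i \<in> I \<Longrightarrow> in_Lp M q (f i)" "q \<ge> 1"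
  shows "Lnorm M q (\<lambda>\<omega>. \<Sum>i\<in>I. f i \<omega>) \<le> (\<Sum>i\<in>I. Lnorm M q (f i))"
  using assms
proof (induction I rule: finite_induct)
  case (insert i I)
  then have "Lnorm M q (\<lambda>\<omega>. f i \<omega> + (\<Sum>i\<in>I. f i \<omega>)) \<le> Lnorm M q (f i) + Lnorm M q (\<lambda>\<omega>. \<Sum>i\<in>I. f i \<omega>)"
    by (intro Lnorm_add_le in_Lp_sum) auto
  with insert show ?case by simp
qed (simp add: Lnorm_zero)

lemma in_Lp_power2_iff:
  assumes "f \<in> borel_measurable M"
  shows "in_Lp M q (\<lambda>\<omega>. (f \<omega>)\<^sup>2) \<longleftrightarrow> in_Lp M (2 * q) f"
  using assms by (simp add: in_Lp_def power_mult)

lemma Lnorm_power2: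
  assumes "q \<ge> 1"
  shows "Lnorm M q (\<lambda>\<omega>. (f \<omega>)\<^sup>2) = (Lnorm M (2 * q) f)\<^sup>2"
proof (rule power_eq_imp_eq_base)
  show "Lnorm M q (\<lambda>\<omega>. (f \<omega>)\<^sup>2) ^ q = ((Lnorm M (2 * q) f)\<^sup>2) ^ q"
    using assms Lnorm_power[of "2 * q" M f] by (simp add: Lnorm_power power_even_abs flip: power_mult)
qed (use assms in auto)

lemma abs_sqrt_power: "\<bar>sqrt x\<bar> ^ (2 * q) = \<bar>x\<bar> ^ q"
  by (simp add: power_mult real_sqrt_abs2 flip: real_sqrt_abs2)

lemma in_Lp_sqrt_iff:
  assumes "f \<in> borel_measurable M"
  shows "in_Lp M (2 * q) (\<lambda>\<omega>. sqrt (f \<omega>)) \<longleftrightarrow> in_Lp M q f"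
  using assms by (simp add: in_Lp_def abs_sqrt_power)

lemma Lnorm_sqrt:
  assumes "q \<ge> 1"
  shows "Lnorm M (2 * q) (\<lambda>\<omega>. sqrt (f \<omega>)) = sqrt (Lnorm M q f)"
  unfolding Lnorm_def abs_sqrt_power real_root_mult_exp by (simp add: sqrt_def)

text \<open>By monotone convergence the sum, taken in \<open>ennreal\<close>, has finite integral
  and is therefore finite almost everywhere.\<close>

lemma AE_summable_of_integral_le:
  fixes h :: "nat \<Rightarrow> 'w \<Rightarrow> real"
  assumes h: "\<And>k. integrable M (h k)" and nonneg: "\<And>k \<omega>. 0 \<le> h k \<omega>"
    and le: "\<And>k. (\<integral>\<omega>. h k \<omega> \<partial>M) \<le> c k" and c: "summable c"
  shows "AE \<omega> in M. summable (\<lambda>k. h k \<omega>)"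
proof -
  have [measurable]: "h k \<in> borel_measurable M" for k
    using h by auto
  have c0: "0 \<le> c k" for k
    using order_trans[OF _ le[of k]] nonneg by (simp add: integral_nonneg_AE)
  have "(\<integral>\<^sup>+\<omega>. (\<Sum>k. ennreal (h k \<omega>)) \<partial>M) = (\<Sum>k. \<integral>\<^sup>+\<omega>. ennreal (h k \<omega>) \<partial>M)"
    by (intro nn_integral_suminf) auto
  also have "\<dots> \<le> (\<Sum>k. ennreal (c k))"
    using h nonneg le by (intro suminf_le) (auto simp: nn_integral_eq_integral intro!: ennreal_leI)
  also have "\<dots> < \<infinity>"
    using c c0 by (simp add: suminf_ennreal2)
  finally have "AE \<omega> in M. (\<Sum>k. ennreal (h k \<omega>)) \<noteq> \<infinity>"
    by (intro nn_integral_noteq_infinite) auto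
  then show ?thesis
    by (rule AE_mp) (auto intro!: AE_I2 summable_suminf_not_top nonneg)
qed

text \<open>Fatou's lemma applied to the \<open>q\<close>-th powers. It yields integrability and a
  norm bound for an almost sure limit before any convergence in norm is known.\<close>

lemma Fatou_Lp:
  fixes F :: "nat \<Rightarrow> 'w \<Rightarrow> real"
  assumes F: "\<And>n. in_Lp M q (F n)" and le: "\<And>n. (\<integral>\<omega>. \<bar>F n \<omega>\<bar> ^ q \<partial>M) \<le> C"
    and lim: "AE \<omega> in M. (\<lambda>n. F n \<omega>) \<longlonglongrightarrow> f \<omega>" and [measurable]: "f \<in> borel_measurable M"
  shows "in_Lp M q f" and "(\<integral>\<omega>. \<bar>f \<omega>\<bar> ^ q \<partial>M) \<le> C"
proof -
  have [measurable]: "F n \<in> borel_measurable M" for n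
    using F by (auto simp: in_Lp_def)
  have C: "0 \<le> C"
    by (rule order_trans[OF _ le[of 0]]) (auto intro!: integral_nonneg_AE)
  have "(\<integral>\<^sup>+\<omega>. ennreal (\<bar>f \<omega>\<bar> ^ q) \<partial>M) = (\<integral>\<^sup>+\<omega>. liminf (\<lambda>n. ennreal (\<bar>F n \<omega>\<bar> ^ q)) \<partial>M)"
  proof (rule nn_integral_cong_AE)
    show "AE \<omega> in M. ennreal (\<bar>f \<omega>\<bar> ^ q) = liminf (\<lambda>n. ennreal (\<bar>F n \<omega>\<bar> ^ q))"
      using lim
    proof eventually_elim
      fix \<omega> assume "(\<lambda>n. F n \<omega>) \<longlonglongrightarrow> f \<omega>"
      then have "(\<lambda>n. ennreal (\<bar>F n \<omega>\<bar> ^ q)) \<longlonglongrightarrow> ennreal (\<bar>f \<omega>\<bar> ^ q)"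
        by (intro tendsto_ennrealI tendsto_intros)
      from lim_imp_Liminf[OF _ this]
      show "ennreal (\<bar>f \<omega>\<bar> ^ q) = liminf (\<lambda>n. ennreal (\<bar>F n \<omega>\<bar> ^ q))"
        by simp
    qed
  qed
  also have "\<dots> \<le> liminf (\<lambda>n. \<integral>\<^sup>+\<omega>. ennreal (\<bar>F n \<omega>\<bar> ^ q) \<partial>M)"
    by (intro nn_integral_liminf) auto
  also have "\<dots> = liminf (\<lambda>n. ennreal (\<integral>\<omega>. \<bar>F n \<omega>\<bar> ^ q \<partial>M))"
    using F by (simp add: in_Lp_def nn_integral_eq_integral)
  also have "\<dots> \<le> ennreal C"
    using le by (intro Liminf_le) (auto intro!: always_eventually ennreal_leI)
  finally have *: "(\<integral>\<^sup>+\<omega>. ennreal (\<bar>f \<omega>\<bar> ^ q) \<partial>M) \<le> ennreal C" .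
  then have int: "integrable M (\<lambda>\<omega>. \<bar>f \<omega>\<bar> ^ q)"
    by (intro integrableI_bounded) (auto simp: less_top[symmetric] top_unique)
  then show "in_Lp M q f"
    by (simp add: in_Lp_def)
  show "(\<integral>\<omega>. \<bar>f \<omega>\<bar> ^ q \<partial>M) \<le> C"
    using * int C by (simp add: nn_integral_eq_integral)
qed

lemma (in prob_space) integrable_in_Lp:
  assumes "in_Lp M q f" "q \<ge> 1"
  shows "integrable M f"
proof (rule Bochner_Integration.integrable_bound)
  show "integrable M (\<lambda>\<omega>. 1 + \<bar>f \<omega>\<bar> ^ q)" "f \<in> borel_measurable M"
    using assms by (auto simp: in_Lp_def)
  show "AE \<omega> in M. norm (f \<omega>) \<le> norm (1 + \<bar>f \<omega>\<bar> ^ q)"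
    using abs_le_add_power[of 1 q "f _"] assms(2) by auto
qed

lemma (in prob_space) expectation_abs_le_add:
  assumes "in_Lp M q f" "q \<ge> 1" "d > 0"
  shows "expectation (\<lambda>\<omega>. \<bar>f \<omega>\<bar>) \<le> d + expectation (\<lambda>\<omega>. \<bar>f \<omega>\<bar> ^ q) / d ^ (q - 1)"
proof -
  have "expectation (\<lambda>\<omega>. \<bar>f \<omega>\<bar>) \<le> expectation (\<lambda>\<omega>. d + \<bar>f \<omega>\<bar> ^ q / d ^ (q - 1))"
    using assms integrable_in_Lp[OF assms(1,2)]
    by (intro integral_mono abs_le_add_power) (auto simp: in_Lp_def)
  then show ?thesis
    using assms by (simp add: in_Lp_def prob_space)
qed

text \<open>The Riesz-Fischer argument: a subsequence whose increments have norm below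
  \<open>(1/2) ^ k\<close> has summable increments in mean, hence converges almost surely. Fatou's
  lemma then turns the Cauchy estimate into an estimate against the limit.\<close>

lemma (in prob_space) Lp_complete:
  assumes q: "q \<ge> 1" and F: "\<And>n. in_Lp M q (F n)"
    and Cauchy: "\<And>e. e > 0 \<Longrightarrow> \<exists>N. \<forall>m\<ge>N. \<forall>n\<ge>N. Lnorm M q (\<lambda>\<omega>. F m \<omega> - F n \<omega>) < e"
  obtains f where "tendsto_Lp M q F f"
proof -
  have [measurable]: "F n \<in> borel_measurable M" for n
    using F by (auto simp: in_Lp_def)
  have "\<forall>k. \<exists>N. \<forall>m\<ge>N. \<forall>n\<ge>N. Lnorm M q (\<lambda>\<omega>. F m \<omega> - F n \<omega>) < (1/2) ^ k"
    using Cauchy by simp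
  then obtain N where N: "\<And>k m n. m \<ge> N k \<Longrightarrow> n \<ge> N k \<Longrightarrow> Lnorm M q (\<lambda>\<omega>. F m \<omega> - F n \<omega>) < (1/2) ^ k"
    by metis
  \<comment> \<open>The thresholds \<open>N\<close> need not be increasing; the maximum gives
    \<open>N k \<le> r j\<close> for all \<open>k \<le> j\<close>.\<close>
  define r where "r k = (MAX i\<in>{..k}. N i) + k" for k
  have rN: "N k \<le> r j" if "k \<le> j" for k j
    using that unfolding r_def by (intro trans_le_add1 Max_ge) auto
  define G where "G k = F (r k)" for k
  \<comment> \<open>Being a total function, \<open>lim\<close> gives a measurable \<open>f\<close>
    on the whole space; it is the true limit only off a null set.\<close>
  define f where "f \<omega> = lim (\<lambda>k. G k \<omega>)" for \<omega>
  have [measurable]: "G k \<in> borel_measurable M" for k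
    by (simp add: G_def)
  have [measurable]: "f \<in> borel_measurable M"
    unfolding f_def by measurable
  have GL: "in_Lp M q (\<lambda>\<omega>. G (Suc k) \<omega> - G k \<omega>)" for k
    using F q by (auto simp: G_def intro: in_Lp_diff)
  have "expectation (\<lambda>\<omega>. \<bar>G (Suc k) \<omega> - G k \<omega>\<bar>) \<le> 2 * (1/2) ^ k" for k
  proof -
    \<comment> \<open>With \<open>d\<close> equal to the bound on the norm of the increment, both
      terms of \<open>expectation_abs_le_add\<close> are at most \<open>d\<close>.\<close>
    define d :: real where "d = (1/2) ^ k"
    have "d > 0" by (simp add: d_def)
    have "Lnorm M q (\<lambda>\<omega>. G (Suc k) \<omega> - G k \<omega>) \<le> d"
      using N[of k "r (Suc k)" "r k"] rN by (simp add: G_def d_def)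
    then have "expectation (\<lambda>\<omega>. \<bar>G (Suc k) \<omega> - G k \<omega>\<bar> ^ q) \<le> d ^ q"
      by (rule Lnorm_leD[OF q])
    then have "expectation (\<lambda>\<omega>. \<bar>G (Suc k) \<omega> - G k \<omega>\<bar> ^ q) / d ^ (q - 1) \<le> d ^ q / d ^ (q - 1)"
      using \<open>d > 0\<close> by (intro divide_right_mono) auto
    also have "\<dots> = d"
      using \<open>d > 0\<close> q power_Suc[of d "q - 1"] by (simp del: power_Suc)
    finally show ?thesis
      using expectation_abs_le_add[OF GL q \<open>d > 0\<close>, of k] by (simp add: d_def)
  qed
  then have "AE \<omega> in M. summable (\<lambda>k. \<bar>G (Suc k) \<omega> - G k \<omega>\<bar>)"
    using integrable_in_Lp[OF GL q]
    by (intro AE_summable_of_integral_le[where c = "\<lambda>k. 2 * (1/2) ^ k"] summable_mult summable_geometric) auto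
  then have conv: "AE \<omega> in M. (\<lambda>k. G k \<omega>) \<longlonglongrightarrow> f \<omega>"
  proof eventually_elim
    fix \<omega> assume "summable (\<lambda>k. \<bar>G (Suc k) \<omega> - G k \<omega>\<bar>)"
    then have "summable (\<lambda>k. G (Suc k) \<omega> - G k \<omega>)"
      by (rule summable_rabs_cancel)
    then have "(\<lambda>n. \<Sum>k<n. G (Suc k) \<omega> - G k \<omega>) \<longlonglongrightarrow> (\<Sum>k. G (Suc k) \<omega> - G k \<omega>)"
      by (rule summable_LIMSEQ)
    then have "(\<lambda>n. G n \<omega> - G 0 \<omega> + G 0 \<omega>) \<longlonglongrightarrow> (\<Sum>k. G (Suc k) \<omega> - G k \<omega>) + G 0 \<omega>"
      using sum_lessThan_telescope[of "\<lambda>k. G k \<omega>"] by (intro tendsto_add tendsto_const) simp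
    then have "convergent (\<lambda>k. G k \<omega>)"
      by (auto simp: convergent_def)
    then show "(\<lambda>k. G k \<omega>) \<longlonglongrightarrow> f \<omega>"
      by (simp add: f_def convergent_LIMSEQ_iff)
  qed
  \<comment> \<open>Here \<open>n\<close> is fixed and the subsequence runs to its limit; the shift
    by \<open>k\<close> keeps its indices beyond \<open>N k\<close>.\<close>
  have bound: "in_Lp M q (\<lambda>\<omega>. F n \<omega> - f \<omega>) \<and> Lnorm M q (\<lambda>\<omega>. F n \<omega> - f \<omega>) \<le> (1/2) ^ k" if "n \<ge> N k" for n k
  proof -
    have le: "(\<integral>\<omega>. \<bar>F n \<omega> - G (j + k) \<omega>\<bar> ^ q \<partial>M) \<le> ((1/2) ^ k) ^ q" for j
      using N[of k n "r (j + k)"] that rN[of k "j + k"]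
      unfolding G_def by (intro Lnorm_leD[OF q] less_imp_le) auto
    have lim: "AE \<omega> in M. (\<lambda>j. F n \<omega> - G (j + k) \<omega>) \<longlonglongrightarrow> F n \<omega> - f \<omega>"
      using conv by eventually_elim (intro tendsto_diff tendsto_const LIMSEQ_ignore_initial_segment)
    have L: "in_Lp M q (\<lambda>\<omega>. F n \<omega> - G (j + k) \<omega>)" for j
      using F q by (auto simp: G_def intro: in_Lp_diff)
    have "in_Lp M q (\<lambda>\<omega>. F n \<omega> - f \<omega>)" "(\<integral>\<omega>. \<bar>F n \<omega> - f \<omega>\<bar> ^ q \<partial>M) \<le> ((1/2) ^ k) ^ q"
      by (rule Fatou_Lp[OF L le lim], measurable)+
    then show ?thesis
      using q by (simp add: Lnorm_le_iff)
  qed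
  have "in_Lp M q f"
    using in_Lp_diff[OF F[of "N 0"] conjunct1[OF bound[of 0 "N 0"]] q] by simp
  moreover have "(\<lambda>n. Lnorm M q (\<lambda>\<omega>. F n \<omega> - f \<omega>)) \<longlonglongrightarrow> 0"
  proof (rule LIMSEQ_I)
    fix e :: real assume "e > 0"
    then obtain k where "(1/2) ^ k < e"
      using real_arch_pow_inv[of e "1/2"] by auto
    then show "\<exists>n0. \<forall>n\<ge>n0. norm (Lnorm M q (\<lambda>\<omega>. F n \<omega> - f \<omega>) - 0) < e"
      using le_less_trans[OF conjunct2[OF bound]] by (intro exI[of _ "N k"]) simp
  qed
  ultimately have "tendsto_Lp M q F f"
    using F q by (simp add: tendsto_Lp_iff_Lnorm)
  then show ?thesis ..
qed

text \<open>Banach's fixed-point theorem by iteration from 0. The map acts on functions rather than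
  on classes; the contraction estimate makes it respect almost sure equality, and the fixed-point
  equation holds in that sense.\<close>

lemma (in prob_space) Lp_contraction_fixpoint:
  fixes T :: "('a \<Rightarrow> real) \<Rightarrow> 'a \<Rightarrow> real"
  assumes q: "q \<ge> 1" and r: "0 \<le> r" "r < 1" and T: "\<And>f. in_Lp M q f \<Longrightarrow> in_Lp M q (T f)"
    and contr: "\<And>f g. in_Lp M q f \<Longrightarrow> in_Lp M q g \<Longrightarrow>
      Lnorm M q (\<lambda>\<omega>. T f \<omega> - T g \<omega>) \<le> r * Lnorm M q (\<lambda>\<omega>. f \<omega> - g \<omega>)"
  obtains f where "in_Lp M q f" "AE \<omega> in M. T f \<omega> = f \<omega>"
proof -
  define F where "F n = (T ^^ n) (\<lambda>_. 0)" for n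
  have F_Suc: "F (Suc n) = T (F n)" for n
    by (simp add: F_def)
  have F: "in_Lp M q (F n)" for n
    by (induction n) (auto simp: F_Suc T, simp add: F_def in_Lp_zero[OF q, simplified])
  define D where "D = Lnorm M q (\<lambda>\<omega>. F 1 \<omega> - F 0 \<omega>)"
  have step: "Lnorm M q (\<lambda>\<omega>. F (Suc n) \<omega> - F n \<omega>) \<le> r ^ n * D" for n
  proof (induction n)
    case (Suc n)
    have "Lnorm M q (\<lambda>\<omega>. F (Suc (Suc n)) \<omega> - F (Suc n) \<omega>) \<le> r * Lnorm M q (\<lambda>\<omega>. F (Suc n) \<omega> - F n \<omega>)"
      unfolding F_Suc[of "Suc n"] F_Suc[of n] using contr[OF F F, of "Suc n" n] by (simp add: F_Suc)
    also have "\<dots> \<le> r * (r ^ n * D)"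
      using Suc r by (intro mult_left_mono) auto
    finally show ?case by (simp add: mult_ac)
  qed (simp add: D_def)
  have D: "0 \<le> D"
    by (simp add: D_def)
  \<comment> \<open>With the factor \<open>1 - r\<close> the geometric sum telescopes:
    \<open>(1 - r) * r ^ (n + k) = r ^ n * (r ^ k - r ^ Suc k)\<close>.\<close>
  have far: "(1 - r) * Lnorm M q (\<lambda>\<omega>. F (n + k) \<omega> - F n \<omega>) \<le> r ^ n * D * (1 - r ^ k)" for n k
  proof (induction k)
    case 0
    then show ?case using q by (simp add: Lnorm_zero)
  next
    case (Suc k)
    have "Lnorm M q (\<lambda>\<omega>. F (n + Suc k) \<omega> - F n \<omega>)
        \<le> Lnorm M q (\<lambda>\<omega>. F (Suc (n + k)) \<omega> - F (n + k) \<omega>) + Lnorm M q (\<lambda>\<omega>. F (n + k) \<omega> - F n \<omega>)"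
      using Lnorm_diff_triangle[OF F F F q, of "Suc (n + k)" n "n + k"] by simp
    also have "\<dots> \<le> r ^ (n + k) * D + Lnorm M q (\<lambda>\<omega>. F (n + k) \<omega> - F n \<omega>)"
      using step by simp
    finally have "(1 - r) * Lnorm M q (\<lambda>\<omega>. F (n + Suc k) \<omega> - F n \<omega>)
        \<le> (1 - r) * (r ^ (n + k) * D + Lnorm M q (\<lambda>\<omega>. F (n + k) \<omega> - F n \<omega>))"
      using r by (intro mult_left_mono) auto
    also have "\<dots> \<le> (1 - r) * (r ^ (n + k) * D) + r ^ n * D * (1 - r ^ k)"
      using Suc by (simp add: distrib_left)
    also have "\<dots> = r ^ n * D * (1 - r ^ Suc k)"
      by (simp add: algebra_simps power_add)
    finally show ?case .
  qed
  have far': "Lnorm M q (\<lambda>\<omega>. F m \<omega> - F n \<omega>) \<le> r ^ n * (D / (1 - r))" if "n \<le> m" for m n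
  proof -
    have "r ^ n * D * (1 - r ^ (m - n)) \<le> r ^ n * D * 1"
      using r D by (intro mult_left_mono) auto
    then have "(1 - r) * Lnorm M q (\<lambda>\<omega>. F m \<omega> - F n \<omega>) \<le> r ^ n * D"
      using far[of n "m - n"] that by simp
    then show ?thesis
      using r by (simp add: pos_le_divide_eq mult.commute)
  qed
  have lim0: "(\<lambda>n. r ^ n * (D / (1 - r))) \<longlonglongrightarrow> 0"
    using r by (intro tendsto_mult_left_zero LIMSEQ_realpow_zero) auto
  have "\<exists>N. \<forall>m\<ge>N. \<forall>n\<ge>N. Lnorm M q (\<lambda>\<omega>. F m \<omega> - F n \<omega>) < e" if e: "e > 0" for e
  proof -
    obtain N where N: "\<And>n. n \<ge> N \<Longrightarrow> r ^ n * (D / (1 - r)) < e"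
      using order_tendstoD(2)[OF lim0 e] by (auto simp: eventually_sequentially)
    have "Lnorm M q (\<lambda>\<omega>. F m \<omega> - F n \<omega>) < e" if "m \<ge> N" "n \<ge> N" for m n
    proof (cases "n \<le> m")
      case True
      then show ?thesis using far'[OF True] N[OF that(2)] by simp
    next
      case False
      then show ?thesis
        using far'[of m n] N[OF that(1)] Lnorm_minus_commute[of M q "F m" "F n"] by simp
    qed
    then show ?thesis by blast
  qed
  from Lp_complete[OF q F this] obtain f where f: "tendsto_Lp M q F f" .
  then have fL: "in_Lp M q f" and lim: "(\<lambda>n. Lnorm M q (\<lambda>\<omega>. F n \<omega> - f \<omega>)) \<longlonglongrightarrow> 0"
    by (simp_all add: tendsto_Lp_iff_Lnorm[OF q])
  have "Lnorm M q (\<lambda>\<omega>. T f \<omega> - f \<omega>) \<le> r * Lnorm M q (\<lambda>\<omega>. F n \<omega> - f \<omega>) + Lnorm M q (\<lambda>\<omega>. F (Suc n) \<omega> - f \<omega>)" for n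
    using Lnorm_diff_triangle[OF T[OF fL] F[of "Suc n"] fL q] contr[OF fL F[of n]]
    by (simp add: F_Suc Lnorm_minus_commute[of M q f])
  moreover have "(\<lambda>n. r * Lnorm M q (\<lambda>\<omega>. F n \<omega> - f \<omega>) + Lnorm M q (\<lambda>\<omega>. F (Suc n) \<omega> - f \<omega>)) \<longlonglongrightarrow> r * 0 + 0"
    by (intro tendsto_intros lim LIMSEQ_Suc[OF lim])
  ultimately have "Lnorm M q (\<lambda>\<omega>. T f \<omega> - f \<omega>) \<le> r * 0 + 0"
    by (intro LIMSEQ_le_const[of _ "r * 0 + 0"]) auto
  then have "Lnorm M q (\<lambda>\<omega>. T f \<omega> - f \<omega>) = 0"
    using Lnorm_nonneg[of M q "\<lambda>\<omega>. T f \<omega> - f \<omega>"] by simp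
  then have "AE \<omega> in M. T f \<omega> - f \<omega> = 0"
    by (rule Lnorm_eq_0_imp_AE[OF in_Lp_diff[OF T[OF fL] fL q] q])
  with fL show ?thesis
    by (intro that[of f]) auto
qed

subsection \<open>Martingale differences driven by i.i.d. noise\<close>

text \<open>Weighted arithmetic-geometric mean inequality for \<open>x ^ p\<close> and
  \<open>y ^ p\<close>. The weights sum to 1, so a common bound on the \<open>p\<close>-th powers
  also bounds the mixed product. The boundary cases are split off to have positive bases and weights
  for \<open>powr\<close>.\<close>

lemma Young_power:
  fixes x y :: real
  assumes "0 \<le> x" "0 \<le> y" "j \<le> p" "1 \<le> p"
  shows "x ^ j * y ^ (p - j) \<le> real j / real p * x ^ p + real (p - j) / real p * y ^ p"
proof -
  consider "j = 0" | "j = p" | "0 < j" "j < p" "x = 0 \<or> y = 0" | "0 < j" "j < p" "0 < x" "0 < y"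
    using assms by linarith
  then show ?thesis
  proof cases
    case 4
    have "(x ^ p) powr (real j / real p) * (y ^ p) powr (real (p - j) / real p)
        \<le> real j / real p * x ^ p + real (p - j) / real p * y ^ p"
      using 4 by (intro Youngs_inequality_0) (auto simp: field_simps of_nat_diff)
    moreover have "(x ^ p) powr (real j / real p) = x ^ j" "(y ^ p) powr (real (p - j) / real p) = y ^ (p - j)"
      using 4 by (simp_all add: powr_powr flip: powr_realpow)
    ultimately show ?thesis by simp
  qed (use assms in \<open>auto simp: power_0_left\<close>)
qed

locale iid_noise = prob_space M for M :: "'w measure" +
  fixes \<zeta> :: "int \<Rightarrow> 'w \<Rightarrow> real" and p :: nat
  assumes iid: "iid M \<zeta>" and even_p: "even p" and p_ge_2: "p \<ge> 2"
    and integrable_noise: "integrable M (\<lambda>\<omega>. \<bar>\<zeta> 0 \<omega>\<bar> ^ p)"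
    and mean_zero: "(\<integral>\<omega>. \<zeta> 0 \<omega> \<partial>M) = 0"
begin

section \<open>Measurability with respect to the past, independence and moments of the noise\<close>

lemma p_ge_1: "p \<ge> 1"
  using p_ge_2 by simp

lemma noise_measurable [measurable]: "\<zeta> s \<in> borel_measurable M"
  using iid by (auto simp: iid_def indep_vars_def)

lemma noise_generators_events: "{\<zeta> s -` A \<inter> space M |s A. s \<le> t \<and> A \<in> sets borel} \<subseteq> events"
  by auto

lemma space_past [simp]: "space (past M \<zeta> t) = space M"
  by (simp add: past_def space_measure_of_conv)

lemma sets_past: "sets (past M \<zeta> t) = sigma_sets (space M) {\<zeta> s -` A \<inter> space M |s A. s \<le> t \<and> A \<in> sets borel}"
  unfolding past_def by (rule sets_measure_of) auto

lemma subalgebra_past: "subalgebra M (past M \<zeta> t)"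
  unfolding subalgebra_def sets_past space_past
  using sets.sigma_sets_subset[OF noise_generators_events] by simp

lemmas measurable_past = measurable_from_subalg[OF subalgebra_past]

lemma measurable_past_mono:
  assumes "s \<le> t" "f \<in> borel_measurable (past M \<zeta> s)"
  shows "f \<in> borel_measurable (past M \<zeta> t)"
proof (rule measurable_from_subalg[OF _ assms(2)])
  show "subalgebra (past M \<zeta> t) (past M \<zeta> s)"
    unfolding subalgebra_def sets_past space_past using \<open>s \<le> t\<close>
    by (intro conjI refl sigma_sets_mono') fastforce
qed

lemma noise_measurable_past: "s \<le> t \<Longrightarrow> \<zeta> s \<in> borel_measurable (past M \<zeta> t)"
  by (rule measurableI) (auto simp: sets_past)

text \<open>Grouping of independent families: the index sets \<open>{s}\<close> and
  \<open>{..s - 1}\<close> are disjoint and each generating family is closed under intersection, so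
  the generated sigma-algebras are independent. This is what lets expectations factor in the
  martingale estimate.\<close>

lemma noise_past_indep:
  assumes Z: "Z \<in> borel_measurable (past M \<zeta> (s - 1))"
  shows "indep_var borel (\<zeta> s) borel Z"
proof -
  have [measurable]: "Z \<in> borel_measurable M"
    by (rule measurable_past[OF Z])
  define E where "E r = {\<zeta> r -` A \<inter> space M |A. A \<in> sets borel}" for r
  define I where "I = case_bool {s} {..s - 1}"
  have "indep_sets E UNIV"
    using iid unfolding iid_def indep_vars_def2 E_def[abs_def] by simp
  then have "indep_sets E (\<Union>j\<in>UNIV. I j)"
    by (rule indep_sets_mono_index[rotated]) auto
  moreover have "Int_stable (E r)" for r
    unfolding E_def Int_stable_def
  proof safe
    fix A B :: "real set" assume "A \<in> sets borel" "B \<in> sets borel"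
    then show "\<exists>C. \<zeta> r -` A \<inter> space M \<inter> (\<zeta> r -` B \<inter> space M) = \<zeta> r -` C \<inter> space M \<and> C \<in> sets borel"
      by (intro exI[of _ "A \<inter> B"]) auto
  qed
  moreover have "disjoint_family_on I UNIV"
    by (auto simp: disjoint_family_on_def I_def split: bool.splits)
  ultimately have "indep_sets (\<lambda>j. sigma_sets (space M) (\<Union>i\<in>I j. E i)) UNIV"
    by (intro indep_sets_collect_sigma)
  then have "indep_set (sigma_sets (space M) {\<zeta> s -` A \<inter> space M |A. A \<in> sets borel})
      (sigma_sets (space M) {Z -` A \<inter> space M |A. A \<in> sets borel})"
    unfolding indep_set_def
  proof (rule indep_sets_mono_sets)
    fix j :: bool
    show "case_bool (sigma_sets (space M) {\<zeta> s -` A \<inter> space M |A. A \<in> sets borel})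
        (sigma_sets (space M) {Z -` A \<inter> space M |A. A \<in> sets borel}) j
        \<subseteq> sigma_sets (space M) (\<Union>i\<in>I j. E i)"
    proof (cases j)
      case True
      then show ?thesis by (simp add: I_def E_def)
    next
      case False
      have "(\<Union>i\<in>I j. E i) = {\<zeta> r -` A \<inter> space M |r A. r \<le> s - 1 \<and> A \<in> sets borel}"
        using False unfolding I_def E_def by fastforce
      then have "sigma_sets (space M) (\<Union>i\<in>I j. E i) = sets (past M \<zeta> (s - 1))"
        by (simp add: sets_past)
      moreover have "{Z -` A \<inter> space M |A. A \<in> sets borel} \<subseteq> sets (past M \<zeta> (s - 1))"
        using measurable_sets[OF Z] by auto
      ultimately show ?thesis
        using False sets.sigma_sets_subset[of _ "past M \<zeta> (s - 1)"] by simp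
    qed
  qed
  then show ?thesis
    by (simp add: indep_var_eq)
qed

lemma noise_distr: "distr M borel (\<zeta> s) = distr M borel (\<zeta> 0)"
  using iid by (simp add: iid_def)

lemma noise_moment_eq: "expectation (\<lambda>\<omega>. \<zeta> s \<omega> ^ j) = expectation (\<lambda>\<omega>. \<zeta> 0 \<omega> ^ j)"
  using integral_distr[of "\<zeta> s" M borel "\<lambda>x. x ^ j"] integral_distr[of "\<zeta> 0" M borel "\<lambda>x. x ^ j"] noise_distr[of s]
  by simp

lemma noise_moment:
  assumes "j \<le> p"
  shows "integrable M (\<lambda>\<omega>. \<zeta> s \<omega> ^ j)"
proof -
  have "integrable M (\<lambda>\<omega>. \<zeta> 0 \<omega> ^ j)"
  proof (rule Bochner_Integration.integrable_bound)
    show "integrable M (\<lambda>\<omega>. 1 + \<bar>\<zeta> 0 \<omega>\<bar> ^ p)"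
      using integrable_noise by simp
    have "\<bar>x\<bar> ^ j \<le> 1 + \<bar>x\<bar> ^ p" for x :: real
    proof (cases "\<bar>x\<bar> \<le> 1")
      case True
      then show ?thesis by (simp add: power_le_one add_increasing2)
    next
      case False
      then have "\<bar>x\<bar> ^ j \<le> \<bar>x\<bar> ^ p"
        using \<open>j \<le> p\<close> by (intro power_increasing) auto
      then show ?thesis by linarith
    qed
    then show "AE \<omega> in M. norm (\<zeta> 0 \<omega> ^ j) \<le> norm (1 + \<bar>\<zeta> 0 \<omega>\<bar> ^ p)"
      by (simp add: power_abs)
  qed simp
  then show ?thesis
    using integrable_distr_eq[of "\<zeta> s" M borel "\<lambda>x. x ^ j"] integrable_distr_eq[of "\<zeta> 0" M borel "\<lambda>x. x ^ j"]
      noise_distr[of s] by simp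
qed

text \<open>The orders from 2 on in the binomial expansion after adding a term
  \<open>c * \<zeta> s * u\<close>, with every mixed moment replaced by a common bound. Summing
  \<open>kap (Lip * b k)\<close> over \<open>k \<ge> 1\<close> gives the left side of the moment
  condition.\<close>

definition kap :: "real \<Rightarrow> real" where
  "kap c = (\<Sum>j=2..p. real (p choose j) * \<bar>\<integral>\<omega>. \<zeta> 0 \<omega> ^ j \<partial>M\<bar> * \<bar>c\<bar> ^ j)"

lemma kap_nonneg [simp]: "0 \<le> kap c"
  by (simp add: kap_def sum_nonneg)

text \<open>Young's inequality applied pointwise and integrated; since its weights sum to 1, the
  common bound \<open>D\<close> is reproduced without a constant.\<close>

lemma mixed_moment:
  assumes u: "in_Lp M p u" "expectation (\<lambda>\<omega>. \<bar>u \<omega>\<bar> ^ p) \<le> D"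
    and S: "in_Lp M p S" "expectation (\<lambda>\<omega>. \<bar>S \<omega>\<bar> ^ p) \<le> D" and j: "j \<le> p"
  shows "integrable M (\<lambda>\<omega>. u \<omega> ^ j * S \<omega> ^ (p - j))"
    and "\<bar>expectation (\<lambda>\<omega>. u \<omega> ^ j * S \<omega> ^ (p - j))\<bar> \<le> D"
proof -
  have [measurable]: "u \<in> borel_measurable M" "S \<in> borel_measurable M"
    using u S by (auto simp: in_Lp_def)
  let ?Y = "\<lambda>\<omega>. real j / real p * \<bar>u \<omega>\<bar> ^ p + real (p - j) / real p * \<bar>S \<omega>\<bar> ^ p"
  have Y: "integrable M ?Y"
    using u S by (auto simp: in_Lp_def)
  have le: "\<bar>u \<omega> ^ j * S \<omega> ^ (p - j)\<bar> \<le> ?Y \<omega>" for \<omega>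
    using Young_power[of "\<bar>u \<omega>\<bar>" "\<bar>S \<omega>\<bar>" j p] j p_ge_1 by (simp add: abs_mult power_abs)
  show int: "integrable M (\<lambda>\<omega>. u \<omega> ^ j * S \<omega> ^ (p - j))"
    by (rule Bochner_Integration.integrable_bound[OF Y]) (auto intro!: AE_I2 order_trans[OF le])
  have "\<bar>expectation (\<lambda>\<omega>. u \<omega> ^ j * S \<omega> ^ (p - j))\<bar> \<le> expectation (\<lambda>\<omega>. \<bar>u \<omega> ^ j * S \<omega> ^ (p - j)\<bar>)"
    by (rule integral_abs_bound)
  also have "\<dots> \<le> expectation ?Y"
    using int Y le by (intro integral_mono) auto
  also have "\<dots> = real j / real p * expectation (\<lambda>\<omega>. \<bar>u \<omega>\<bar> ^ p) + real (p - j) / real p * expectation (\<lambda>\<omega>. \<bar>S \<omega>\<bar> ^ p)"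
    using u S by (simp add: in_Lp_def)
  also have "\<dots> \<le> real j / real p * D + real (p - j) / real p * D"
    using u S by (intro add_mono mult_left_mono) auto
  also have "\<dots> = D"
    using j p_ge_1 by (simp add: field_simps of_nat_diff)
  finally show "\<bar>expectation (\<lambda>\<omega>. u \<omega> ^ j * S \<omega> ^ (p - j))\<bar> \<le> D" .
qed

text \<open>Since \<open>p\<close> is even, the absolute value disappears and the binomial theorem
  applies. In each term the noise power is independent of the factor built from \<open>u\<close> and
  \<open>S\<close>. Order 0 is the old moment, order 1 vanishes by centering, and the remaining
  orders cost at most \<open>kap c * D\<close>.\<close>

lemma martingale_step:
  assumes u: "u \<in> borel_measurable (past M \<zeta> (s - 1))" "in_Lp M p u" "expectation (\<lambda>\<omega>. \<bar>u \<omega>\<bar> ^ p) \<le> D"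
    and S: "S \<in> borel_measurable (past M \<zeta> (s - 1))" "in_Lp M p S" "expectation (\<lambda>\<omega>. \<bar>S \<omega>\<bar> ^ p) \<le> D"
  shows "in_Lp M p (\<lambda>\<omega>. S \<omega> + c * \<zeta> s \<omega> * u \<omega>)"
    and "expectation (\<lambda>\<omega>. \<bar>S \<omega> + c * \<zeta> s \<omega> * u \<omega>\<bar> ^ p) \<le> expectation (\<lambda>\<omega>. \<bar>S \<omega>\<bar> ^ p) + kap c * D"
proof -
  have [measurable]: "u \<in> borel_measurable M" "S \<in> borel_measurable M"
    using u S by (auto simp: in_Lp_def)
  define V where "V = (\<lambda>j \<omega>. u \<omega> ^ j * S \<omega> ^ (p - j))"
  define T where "T = (\<lambda>j \<omega>. real (p choose j) * c ^ j * (\<zeta> s \<omega> ^ j * V j \<omega>))"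
  have V: "integrable M (V j)" "\<bar>expectation (V j)\<bar> \<le> D" if "j \<le> p" for j
    unfolding V_def by (rule mixed_moment[OF u(2,3) S(2,3) that])+
  have indep: "indep_var borel (\<lambda>\<omega>. \<zeta> s \<omega> ^ j) borel (V j)" for j
  proof -
    have "V j \<in> borel_measurable (past M \<zeta> (s - 1))"
      unfolding V_def using u(1) S(1) by (intro borel_measurable_times borel_measurable_power)
    from indep_var_compose[OF noise_past_indep[OF this], of "\<lambda>x. x ^ j" borel "\<lambda>x. x" borel]
    show ?thesis unfolding comp_def by this simp_all
  qed
  have int: "integrable M (T j)" if "j \<le> p" for j
    unfolding T_def using indep_var_integrable[OF indep] noise_moment V that by auto
  have E: "expectation (T j) = real (p choose j) * c ^ j * (expectation (\<lambda>\<omega>. \<zeta> 0 \<omega> ^ j) * expectation (V j))"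
    if "j \<le> p" for j
    unfolding T_def
    using indep_var_lebesgue_integral[OF indep] noise_moment V that by (simp add: noise_moment_eq[of s])
  have expand: "\<bar>S \<omega> + c * \<zeta> s \<omega> * u \<omega>\<bar> ^ p = (\<Sum>j\<le>p. T j \<omega>)" for \<omega>
  proof -
    have "\<bar>S \<omega> + c * \<zeta> s \<omega> * u \<omega>\<bar> ^ p = (c * \<zeta> s \<omega> * u \<omega> + S \<omega>) ^ p"
      using even_p by (simp add: power_even_abs add.commute)
    also have "\<dots> = (\<Sum>j\<le>p. T j \<omega>)"
      by (simp add: binomial_ring T_def V_def power_mult_distrib mult_ac)
    finally show ?thesis .
  qed
  show "in_Lp M p (\<lambda>\<omega>. S \<omega> + c * \<zeta> s \<omega> * u \<omega>)"
    unfolding in_Lp_def expand using int by auto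
  have T0: "expectation (T 0) = expectation (\<lambda>\<omega>. \<bar>S \<omega>\<bar> ^ p)"
    using even_p by (simp add: T_def V_def power_even_abs)
  have T1: "expectation (T 1) = 0"
    using E[of 1] p_ge_1 mean_zero by simp
  have set: "{..p} = insert 0 (insert 1 {2..p})"
    using p_ge_2 by auto
  have "expectation (\<lambda>\<omega>. \<bar>S \<omega> + c * \<zeta> s \<omega> * u \<omega>\<bar> ^ p) = (\<Sum>j\<le>p. expectation (T j))"
    unfolding expand using int by (intro Bochner_Integration.integral_sum) auto
  also have "\<dots> = expectation (T 0) + (expectation (T 1) + (\<Sum>j=2..p. expectation (T j)))"
    unfolding set by simp
  also have "\<dots> = expectation (\<lambda>\<omega>. \<bar>S \<omega>\<bar> ^ p) + (\<Sum>j=2..p. expectation (T j))"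
    using T0 T1 by simp
  also have "(\<Sum>j=2..p. expectation (T j)) \<le> (\<Sum>j=2..p. real (p choose j) * \<bar>\<integral>\<omega>. \<zeta> 0 \<omega> ^ j \<partial>M\<bar> * \<bar>c\<bar> ^ j * D)"
  proof (rule sum_mono)
    fix j assume "j \<in> {2..p}"
    then have j: "j \<le> p" by simp
    have "expectation (T j) \<le> \<bar>expectation (T j)\<bar>" by simp
    also have "\<dots> = real (p choose j) * \<bar>\<integral>\<omega>. \<zeta> 0 \<omega> ^ j \<partial>M\<bar> * \<bar>c\<bar> ^ j * \<bar>expectation (V j)\<bar>"
      by (simp add: E[OF j] abs_mult power_abs)
    also have "\<dots> \<le> real (p choose j) * \<bar>\<integral>\<omega>. \<zeta> 0 \<omega> ^ j \<partial>M\<bar> * \<bar>c\<bar> ^ j * D"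
      using V(2)[OF j] by (intro mult_left_mono) auto
    finally show "expectation (T j) \<le> real (p choose j) * \<bar>\<integral>\<omega>. \<zeta> 0 \<omega> ^ j \<partial>M\<bar> * \<bar>c\<bar> ^ j * D" .
  qed
  also have "\<dots> = kap c * D"
    by (simp add: kap_def sum_distrib_right)
  finally show "expectation (\<lambda>\<omega>. \<bar>S \<omega> + c * \<zeta> s \<omega> * u \<omega>\<bar> ^ p) \<le> expectation (\<lambda>\<omega>. \<bar>S \<omega>\<bar> ^ p) + kap c * D"
    by simp
qed

text \<open>Terms are added in increasing time, so each new noise variable is independent of the sum
  so far. The bound 1 on the total of \<open>kap\<close> keeps the \<open>p\<close>-th moment of
  that sum below \<open>D\<close>, as the next step requires.\<close>

lemma martingale_sum:
  fixes u :: "int \<Rightarrow> 'w \<Rightarrow> real"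
  assumes u: "\<And>s. u s \<in> borel_measurable (past M \<zeta> (s - 1))" "\<And>s. in_Lp M p (u s)"
      "\<And>s. expectation (\<lambda>\<omega>. \<bar>u s \<omega>\<bar> ^ p) \<le> D"
    and le: "(\<Sum>s\<in>{t..<t + int n}. kap (c s)) \<le> 1"
  shows "(\<lambda>\<omega>. \<Sum>s\<in>{t..<t + int n}. c s * \<zeta> s \<omega> * u s \<omega>) \<in> borel_measurable (past M \<zeta> (t + int n - 1)) \<and>
    in_Lp M p (\<lambda>\<omega>. \<Sum>s\<in>{t..<t + int n}. c s * \<zeta> s \<omega> * u s \<omega>) \<and>
    expectation (\<lambda>\<omega>. \<bar>\<Sum>s\<in>{t..<t + int n}. c s * \<zeta> s \<omega> * u s \<omega>\<bar> ^ p) \<le> (\<Sum>s\<in>{t..<t + int n}. kap (c s)) * D"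
  using le
proof (induction n)
  case 0
  then show ?case using p_ge_1 by (simp add: in_Lp_zero power_0_left)
next
  case (Suc n)
  have D: "0 \<le> D"
    by (rule order_trans[OF _ u(3)[of 0]]) (auto intro!: integral_nonneg_AE)
  define S where "S \<omega> = (\<Sum>s\<in>{t..<t + int n}. c s * \<zeta> s \<omega> * u s \<omega>)" for \<omega>
  let ?s = "t + int n"
  have set: "{t..<t + int (Suc n)} = insert ?s {t..<t + int n}"
    by auto
  have split: "sum f {t..<t + int (Suc n)} = sum f {t..<t + int n} + f ?s" for f :: "int \<Rightarrow> real"
    unfolding set by (simp add: add.commute)
  have le: "(\<Sum>s\<in>{t..<t + int n}. kap (c s)) \<le> 1"
    using Suc.prems kap_nonneg[of "c ?s"] unfolding split by linarith
  note IH = Suc.IH[OF le, folded S_def]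
  have "expectation (\<lambda>\<omega>. \<bar>S \<omega>\<bar> ^ p) \<le> D"
    using IH mult_right_mono[OF le D] by simp
  note step = martingale_step[OF u(1,2,3) _ _ this, of ?s "c ?s"]
  have "(\<lambda>\<omega>. S \<omega> + c ?s * \<zeta> ?s \<omega> * u ?s \<omega>) \<in> borel_measurable (past M \<zeta> ?s)"
    using measurable_past_mono[OF _ conjunct1[OF IH], of ?s] measurable_past_mono[OF _ u(1), of ?s ?s]
      noise_measurable_past[of ?s ?s] by (intro borel_measurable_add borel_measurable_times) auto
  moreover have "in_Lp M p (\<lambda>\<omega>. S \<omega> + c ?s * \<zeta> ?s \<omega> * u ?s \<omega>)"
    "expectation (\<lambda>\<omega>. \<bar>S \<omega> + c ?s * \<zeta> ?s \<omega> * u ?s \<omega>\<bar> ^ p) \<le> expectation (\<lambda>\<omega>. \<bar>S \<omega>\<bar> ^ p) + kap (c ?s) * D"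
    using step IH by simp_all
  ultimately show ?case
    unfolding split using IH by (simp add: S_def distrib_right)
qed

end

subsection \<open>Geometrically weighted series\<close>

text \<open>The triangle inequality bounds the partial sums by a geometric series, and Fatou's lemma
  carries the bound over to the almost sure limit.\<close>

lemma (in prob_space) weighted_series:
  fixes d :: "nat \<Rightarrow> 'a \<Rightarrow> real"
  assumes \<gamma>: "0 \<le> \<gamma>" "\<gamma> < 1" and q: "q \<ge> 1"
    and d: "\<And>l. in_Lp M q (d l)" "\<And>l \<omega>. 0 \<le> d l \<omega>" and le: "\<And>l. Lnorm M q (d l) \<le> B"
  shows "AE \<omega> in M. summable (\<lambda>l. \<gamma> ^ l * d l \<omega>)"
    and "in_Lp M q (\<lambda>\<omega>. \<Sum>l. \<gamma> ^ l * d l \<omega>)"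
    and "Lnorm M q (\<lambda>\<omega>. \<Sum>l. \<gamma> ^ l * d l \<omega>) \<le> B / (1 - \<gamma>)"
proof -
  have [measurable]: "d l \<in> borel_measurable M" for l
    using d by (auto simp: in_Lp_def)
  have B: "0 \<le> B"
    using order_trans[OF Lnorm_nonneg le] .
  have L: "in_Lp M q (\<lambda>\<omega>. \<gamma> ^ l * d l \<omega>)" for l
    by (rule in_Lp_cmult[OF d(1)])
  \<comment> \<open>The choice \<open>d = 1\<close> in \<open>expectation_abs_le_add\<close> bounds
    the first moments uniformly in \<open>l\<close>, so the weights make them summable.\<close>
  have "expectation (d l) \<le> 1 + B ^ q" for l
    using expectation_abs_le_add[OF d(1) q, of 1 l] Lnorm_leD[OF q le, of l] d(2) by simp
  then have "expectation (\<lambda>\<omega>. \<gamma> ^ l * d l \<omega>) \<le> \<gamma> ^ l * (1 + B ^ q)" for l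
    using \<gamma> by (simp add: mult_left_mono)
  then show AE: "AE \<omega> in M. summable (\<lambda>l. \<gamma> ^ l * d l \<omega>)"
    using \<gamma> d integrable_in_Lp[OF L q]
    by (intro AE_summable_of_integral_le[where c = "\<lambda>l. \<gamma> ^ l * (1 + B ^ q)"] summable_mult2 summable_geometric) auto
  define F where "F = (\<lambda>n \<omega>. \<Sum>l<n. \<gamma> ^ l * d l \<omega>)"
  have F: "in_Lp M q (F n)" for n
    unfolding F_def by (rule in_Lp_sum) (use L q in auto)
  have "Lnorm M q (F n) \<le> B / (1 - \<gamma>)" for n
  proof -
    have "Lnorm M q (F n) \<le> (\<Sum>l<n. Lnorm M q (\<lambda>\<omega>. \<gamma> ^ l * d l \<omega>))"
      unfolding F_def by (rule Lnorm_sum_le) (use L q in auto)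
    also have "\<dots> \<le> (\<Sum>l<n. \<gamma> ^ l * B)"
      using \<gamma> q le by (intro sum_mono) (simp add: Lnorm_cmult mult_left_mono)
    also have "\<dots> \<le> (\<Sum>l. \<gamma> ^ l * B)"
      using \<gamma> B by (intro sum_le_suminf summable_mult2 summable_geometric) auto
    also have "\<dots> = B / (1 - \<gamma>)"
      using \<gamma> by (simp add: suminf_mult2[symmetric] suminf_geometric summable_geometric)
    finally show ?thesis .
  qed
  then have int_le: "(\<integral>\<omega>. \<bar>F n \<omega>\<bar> ^ q \<partial>M) \<le> (B / (1 - \<gamma>)) ^ q" for n
    by (rule Lnorm_leD[OF q])
  have lim: "AE \<omega> in M. (\<lambda>n. F n \<omega>) \<longlonglongrightarrow> (\<Sum>l. \<gamma> ^ l * d l \<omega>)"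
    using AE by eventually_elim (simp add: F_def summable_LIMSEQ)
  note Fatou = Fatou_Lp[OF F int_le lim]
  show "in_Lp M q (\<lambda>\<omega>. \<Sum>l. \<gamma> ^ l * d l \<omega>)"
    by (rule Fatou(1)) measurable
  have "(\<integral>\<omega>. \<bar>\<Sum>l. \<gamma> ^ l * d l \<omega>\<bar> ^ q \<partial>M) \<le> (B / (1 - \<gamma>)) ^ q"
    by (rule Fatou(2)) measurable
  then show "Lnorm M q (\<lambda>\<omega>. \<Sum>l. \<gamma> ^ l * d l \<omega>) \<le> B / (1 - \<gamma>)"
    using \<gamma> B q by (simp add: Lnorm_le_iff)
qed

text \<open>The remainder after \<open>n\<close> terms is \<open>\<gamma> ^ n\<close> times a series
  of the same form with shifted terms, whose norm obeys the same bound.\<close>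

lemma (in prob_space) weighted_series_tendsto_Lp:
  fixes d :: "nat \<Rightarrow> 'a \<Rightarrow> real"
  assumes \<gamma>: "0 \<le> \<gamma>" "\<gamma> < 1" and q: "q \<ge> 1"
    and d: "\<And>l. in_Lp M q (d l)" "\<And>l \<omega>. 0 \<le> d l \<omega>" and le: "\<And>l. Lnorm M q (d l) \<le> B"
  shows "tendsto_Lp M q (\<lambda>n \<omega>. \<Sum>l<n. \<gamma> ^ l * d l \<omega>) (\<lambda>\<omega>. \<Sum>l. \<gamma> ^ l * d l \<omega>)"
proof -
  have [measurable]: "d l \<in> borel_measurable M" for l
    using d by (auto simp: in_Lp_def)
  define S where "S = (\<lambda>\<omega>. \<Sum>l. \<gamma> ^ l * d l \<omega>)"
  define F where "F = (\<lambda>n \<omega>. \<Sum>l<n. \<gamma> ^ l * d l \<omega>)"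
  have [measurable]: "S \<in> borel_measurable M" "F n \<in> borel_measurable M" for n
    unfolding S_def F_def by measurable
  have F: "in_Lp M q (F n)" for n
    unfolding F_def by (rule in_Lp_sum) (use in_Lp_cmult[OF d(1)] q in auto)
  have S: "in_Lp M q S"
    unfolding S_def by (rule weighted_series(2)[OF assms])
  have tail: "Lnorm M q (\<lambda>\<omega>. F n \<omega> - S \<omega>) \<le> \<gamma> ^ n * (B / (1 - \<gamma>))" for n
  proof -
    define R where "R = (\<lambda>\<omega>. \<Sum>l. \<gamma> ^ l * d (l + n) \<omega>)"
    have R: "in_Lp M q R" "Lnorm M q R \<le> B / (1 - \<gamma>)"
      unfolding R_def using weighted_series(2,3)[OF \<gamma> q d le] assms by (auto intro!: weighted_series)
    have [measurable]: "R \<in> borel_measurable M"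
      using R by (simp add: in_Lp_def)
    have "AE \<omega> in M. summable (\<lambda>l. \<gamma> ^ l * d l \<omega>)"
      by (rule weighted_series(1)[OF assms])
    moreover have "AE \<omega> in M. summable (\<lambda>l. \<gamma> ^ l * d (l + n) \<omega>)"
      using assms by (intro weighted_series(1)[of \<gamma> q _ B])
    ultimately have "AE \<omega> in M. F n \<omega> - S \<omega> = - (\<gamma> ^ n) * R \<omega>"
    proof eventually_elim
      fix \<omega> assume 1: "summable (\<lambda>l. \<gamma> ^ l * d l \<omega>)" and 2: "summable (\<lambda>l. \<gamma> ^ l * d (l + n) \<omega>)"
      have "S \<omega> = (\<Sum>l. \<gamma> ^ (l + n) * d (l + n) \<omega>) + F n \<omega>"
        unfolding S_def F_def by (rule suminf_split_initial_segment[OF 1])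
      also have "(\<Sum>l. \<gamma> ^ (l + n) * d (l + n) \<omega>) = (\<Sum>l. \<gamma> ^ n * (\<gamma> ^ l * d (l + n) \<omega>))"
        by (simp add: power_add mult_ac)
      also have "\<dots> = \<gamma> ^ n * R \<omega>"
        unfolding R_def by (rule suminf_mult[OF 2])
      finally show "F n \<omega> - S \<omega> = - (\<gamma> ^ n) * R \<omega>" by simp
    qed
    then have "Lnorm M q (\<lambda>\<omega>. F n \<omega> - S \<omega>) = Lnorm M q (\<lambda>\<omega>. - (\<gamma> ^ n) * R \<omega>)"
      by (intro Lnorm_cong_AE) auto
    also have "\<dots> = \<gamma> ^ n * Lnorm M q R"
      unfolding Lnorm_cmult[OF q] using \<gamma> by simp
    also have "\<dots> \<le> \<gamma> ^ n * (B / (1 - \<gamma>))"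
      using \<gamma> R by (intro mult_left_mono) auto
    finally show ?thesis .
  qed
  have "(\<lambda>n. \<gamma> ^ n * (B / (1 - \<gamma>))) \<longlonglongrightarrow> 0"
    using \<gamma> by (intro tendsto_mult_left_zero LIMSEQ_realpow_zero)
  then have "(\<lambda>n. Lnorm M q (\<lambda>\<omega>. F n \<omega> - S \<omega>)) \<longlonglongrightarrow> 0"
    using tail by (rule_tac tendsto_sandwich[of "\<lambda>_. 0"]) auto
  then show ?thesis
    using F S unfolding tendsto_Lp_iff_Lnorm[OF q] F_def S_def by blast
qed

text \<open>The reverse triangle inequality for finite Euclidean norms, followed by a limit. The
  majorant \<open>z\<close> takes the place of the squared differences so that a Lipschitz bound can
  be inserted directly.\<close>

lemma sqrt_suminf_diff_le:
  fixes x y z :: "nat \<Rightarrow> real"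
  assumes x: "summable (\<lambda>l. (x l)\<^sup>2)" and y: "summable (\<lambda>l. (y l)\<^sup>2)" and z: "summable z"
    and le: "\<And>l. (x l - y l)\<^sup>2 \<le> z l"
  shows "\<bar>sqrt (\<Sum>l. (x l)\<^sup>2) - sqrt (\<Sum>l. (y l)\<^sup>2)\<bar> \<le> sqrt (\<Sum>l. z l)"
proof (rule LIMSEQ_le_const2)
  show "(\<lambda>n. \<bar>sqrt (\<Sum>l<n. (x l)\<^sup>2) - sqrt (\<Sum>l<n. (y l)\<^sup>2)\<bar>)
      \<longlonglongrightarrow> \<bar>sqrt (\<Sum>l. (x l)\<^sup>2) - sqrt (\<Sum>l. (y l)\<^sup>2)\<bar>"
    by (intro tendsto_intros summable_LIMSEQ x y)
  have "\<bar>L2_set x {..<n} - L2_set y {..<n}\<bar> \<le> L2_set (\<lambda>l. x l - y l) {..<n}" for n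
    using L2_set_triangle_ineq[of y "\<lambda>l. x l - y l" "{..<n}"] L2_set_triangle_ineq[of x "\<lambda>l. y l - x l" "{..<n}"]
    by (simp add: L2_set_def power2_commute[of "y _" "x _"])
  moreover have "L2_set (\<lambda>l. x l - y l) {..<n} \<le> sqrt (\<Sum>l. z l)" for n
    unfolding L2_set_def real_sqrt_le_iff
    by (rule order_trans[OF sum_mono[OF le] sum_le_suminf[OF z]])
      (use order_trans[OF zero_le_power2 le] in auto)
  ultimately show "\<exists>N. \<forall>n\<ge>N. \<bar>sqrt (\<Sum>l<n. (x l)\<^sup>2) - sqrt (\<Sum>l<n. (y l)\<^sup>2)\<bar> \<le> sqrt (\<Sum>l. z l)"
    unfolding L2_set_def by (meson order_trans)
qed

subsection \<open>The contraction\<close>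

text \<open>In \<open>ennreal\<close> a divergent series is infinite, so \<open>coeff\<close>
  includes the convergence of each series of powers of \<open>b\<close> whose noise moment is
  nonzero.\<close>

locale vol_model = iid_noise M \<zeta> p
  for M :: "'w measure" and \<zeta> :: "int \<Rightarrow> 'w \<Rightarrow> real" and p :: nat +
  fixes \<gamma> a Lip :: real and b :: "nat \<Rightarrow> real" and Q :: "real \<Rightarrow> real"
  assumes \<gamma>_nonneg: "0 \<le> \<gamma>" and \<gamma>_less_1: "\<gamma> < 1" and Lip_pos: "Lip > 0"
    and Lipschitz: "\<And>x y. \<bar>Q x - Q y\<bar> \<le> Lip * \<bar>x - y\<bar>"
    and coeff: "(\<Sum>j=2..p. ennreal (real (p choose j) * \<bar>\<integral>\<omega>. \<zeta> 0 \<omega> ^ j \<partial>M\<bar> * Lip ^ j)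
            * (\<Sum>k. ennreal (\<bar>b (Suc k)\<bar> ^ j))) < ennreal ((1 - \<gamma>) ^ (p div 2))"
begin

text \<open>\<open>V\<close> is the Lipschitz constant of the volatility as a map on processes, with the
  \<open>L\<^sup>p\<close> norms taken uniformly in time.\<close>

definition V :: real where "V = Lip / sqrt (1 - \<gamma>)"

text \<open>The Lipschitz constant \<open>V\<close> is moved from the volatility differences into
  the coefficients. The index is shifted: \<open>\<kappa> k\<close> belongs to lag
  \<open>k + 1\<close>.\<close>

definition \<kappa> :: "nat \<Rightarrow> real" where "\<kappa> k = kap (V * b (Suc k))"

text \<open>The martingale estimate contracts \<open>p\<close>-th powers of norms, hence the
  root.\<close>

definition ratio :: real where "ratio = root p (\<Sum>k. \<kappa> k)"

abbreviation vol :: "(int \<Rightarrow> 'w \<Rightarrow> real) \<Rightarrow> int \<Rightarrow> 'w \<Rightarrow> real" where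
  "vol X s \<omega> \<equiv> sqrt (vol2 \<gamma> Q a X s \<omega>)"

abbreviation series :: "(int \<Rightarrow> 'w \<Rightarrow> real) \<Rightarrow> int \<Rightarrow> nat \<Rightarrow> 'w \<Rightarrow> real" where
  "series u t n \<omega> \<equiv> (\<Sum>s\<in>{t - int n..<t}. b (nat (t - s)) * \<zeta> s \<omega> * u s \<omega>)"

section \<open>From the moment condition to a contraction factor below 1, and the noise
  series\<close>

lemma V_pos: "V > 0"
  using Lip_pos \<gamma>_less_1 by (simp add: V_def)

lemma half_p: "2 * (p div 2) = p" "p div 2 \<ge> 1"
  using even_p p_ge_2 by auto

lemma \<kappa>_nonneg [simp]: "0 \<le> \<kappa> k"
  by (simp add: \<kappa>_def)

text \<open>The factor equals \<open>sqrt (1 - \<gamma>) ^ p\<close>, which is at most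
  \<open>sqrt (1 - \<gamma>) ^ j\<close> because the base is at most 1; this cancels the denominator
  of \<open>V ^ j\<close>. It accounts for the power of \<open>1 - \<gamma>\<close> in the moment
  condition.\<close>

lemma V_power_le: "j \<le> p \<Longrightarrow> (1 - \<gamma>) ^ (p div 2) * V ^ j \<le> Lip ^ j"
proof -
  assume "j \<le> p"
  have "(1 - \<gamma>) ^ (p div 2) = sqrt (1 - \<gamma>) ^ p"
    using \<gamma>_less_1 half_p(1) by (metis diff_ge_0_iff_ge less_imp_le power_mult real_sqrt_pow2)
  also have "\<dots> \<le> sqrt (1 - \<gamma>) ^ j"
    using \<gamma>_nonneg \<gamma>_less_1 \<open>j \<le> p\<close> by (intro power_decreasing) auto
  finally have "(1 - \<gamma>) ^ (p div 2) * V ^ j \<le> sqrt (1 - \<gamma>) ^ j * V ^ j"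
    using V_pos by (intro mult_right_mono) auto
  also have "\<dots> = Lip ^ j"
    using \<gamma>_less_1 by (simp add: V_def flip: power_mult_distrib)
  finally show ?thesis .
qed

text \<open>The moment condition with the sums over \<open>j\<close> and \<open>k\<close>
  interchanged, which is free of convergence questions in \<open>ennreal\<close>. Both sides carry
  the factor \<open>(1 - \<gamma>) ^ (p div 2)\<close>, which is then cancelled.\<close>

lemma suminf_\<kappa>_ennreal: "(\<Sum>k. ennreal (\<kappa> k)) < 1"
proof -
  define m where "m j = real (p choose j) * \<bar>\<integral>\<omega>. \<zeta> 0 \<omega> ^ j \<partial>M\<bar>" for j
  define B where "B j = (\<Sum>k. ennreal (\<bar>b (Suc k)\<bar> ^ j))" for j
  have m: "0 \<le> m j" for j by (simp add: m_def)
  have "ennreal (\<kappa> k) = (\<Sum>j=2..p. ennreal (m j * V ^ j) * ennreal (\<bar>b (Suc k)\<bar> ^ j))" for k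
    using V_pos m by (simp add: \<kappa>_def kap_def m_def abs_mult power_mult_distrib mult_ac
        flip: sum_ennreal ennreal_mult)
  then have eq: "(\<Sum>k. ennreal (\<kappa> k)) = (\<Sum>j=2..p. ennreal (m j * V ^ j) * B j)"
    by (simp add: B_def suminf_sum ennreal_suminf_cmult)
  have "ennreal ((1 - \<gamma>) ^ (p div 2)) * (\<Sum>j=2..p. ennreal (m j * V ^ j) * B j)
      = (\<Sum>j=2..p. ennreal ((1 - \<gamma>) ^ (p div 2) * (m j * V ^ j)) * B j)"
    using \<gamma>_less_1 m V_pos by (simp add: sum_distrib_left mult.assoc ennreal_mult)
  also have "\<dots> \<le> (\<Sum>j=2..p. ennreal (m j * Lip ^ j) * B j)"
    using V_power_le m by (intro sum_mono mult_right_mono ennreal_leI) (auto simp: mult.left_commute mult_left_mono)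
  also have "\<dots> < ennreal ((1 - \<gamma>) ^ (p div 2))"
    using coeff by (simp add: m_def B_def)
  finally have "ennreal ((1 - \<gamma>) ^ (p div 2)) * (\<Sum>k. ennreal (\<kappa> k)) < ennreal ((1 - \<gamma>) ^ (p div 2)) * 1"
    by (simp add: eq)
  then show ?thesis
    by (meson mult_left_mono not_le zero_le)
qed

lemma summable_\<kappa>: "summable \<kappa>" and suminf_\<kappa>: "(\<Sum>k. \<kappa> k) < 1"
proof -
  show s: "summable \<kappa>"
    using suminf_\<kappa>_ennreal by (intro summable_suminf_not_top) (auto simp: top_unique)
  have "ennreal (\<Sum>k. \<kappa> k) < 1"
    using suminf_\<kappa>_ennreal s by (simp add: suminf_ennreal2)
  then show "(\<Sum>k. \<kappa> k) < 1"
    by (simp add: ennreal_less_one_iff)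
qed

lemma ratio: "0 \<le> ratio" "ratio < 1" "ratio ^ p = (\<Sum>k. \<kappa> k)"
proof -
  have 0: "0 \<le> (\<Sum>k. \<kappa> k)"
    by (intro suminf_nonneg summable_\<kappa>) auto
  then show "0 \<le> ratio" "ratio ^ p = (\<Sum>k. \<kappa> k)"
    using p_ge_1 by (simp_all add: ratio_def)
  show "ratio < 1"
    using suminf_\<kappa> p_ge_1 by (simp add: ratio_def)
qed

text \<open>\<open>martingale_sum\<close> with coefficients multiplied by \<open>V\<close> and
  processes divided by \<open>V\<close>, so that the latter have norm at most \<open>C\<close>.
  Starting at 0 a block is a partial sum; in general it is a difference of two partial sums.\<close>

lemma series_block:
  fixes t :: int
  assumes u: "\<And>s. u s \<in> borel_measurable (past M \<zeta> (s - 1))" "\<And>s. in_Lp M p (u s)"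
      "\<And>s. Lnorm M p (u s) \<le> V * C" and mn: "m \<le> n"
  defines "S \<equiv> \<lambda>\<omega>. \<Sum>s\<in>{t - int n..<t - int m}. b (nat (t - s)) * \<zeta> s \<omega> * u s \<omega>"
  shows "in_Lp M p S" and "Lnorm M p S ^ p \<le> (\<Sum>k\<in>{m..<n}. \<kappa> k) * C ^ p"
    and "S \<in> borel_measurable (past M \<zeta> (t - 1))"
proof -
  define c where "c s = V * b (nat (t - s))" for s
  define v where "v = (\<lambda>s \<omega>. (1 / V) * u s \<omega>)"
  define t' where "t' = t - int n"
  have t': "t - int m = t' + int (n - m)"
    using mn by (simp add: t'_def of_nat_diff)
  have S: "S = (\<lambda>\<omega>. \<Sum>s\<in>{t'..<t' + int (n - m)}. c s * \<zeta> s \<omega> * v s \<omega>)"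
    unfolding S_def t' t'_def[symmetric] c_def v_def using V_pos by (intro ext sum.cong) auto
  have v1: "v s \<in> borel_measurable (past M \<zeta> (s - 1))" for s
    unfolding v_def using u(1) by (intro borel_measurable_times borel_measurable_const)
  have v2: "in_Lp M p (v s)" for s
    unfolding v_def by (rule in_Lp_cmult[OF u(2)])
  have "Lnorm M p (v s) \<le> C" for s
    unfolding v_def Lnorm_cmult[OF p_ge_1] using u(3)[of s] V_pos by (simp add: field_simps)
  then have v3: "expectation (\<lambda>\<omega>. \<bar>v s \<omega>\<bar> ^ p) \<le> C ^ p" for s
    by (rule Lnorm_leD[OF p_ge_1])
  \<comment> \<open>Time \<open>s\<close> corresponds to the index \<open>k = t - 1 - s\<close>,
    which matches \<open>b (nat (t - s))\<close> with \<open>b (Suc k)\<close>.\<close>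
  have "(\<Sum>s\<in>{t'..<t' + int (n - m)}. kap (c s)) = (\<Sum>k\<in>{m..<n}. \<kappa> k)"
    unfolding t'[symmetric] t'_def c_def \<kappa>_def
    by (rule sum.reindex_bij_witness[of _ "\<lambda>k. t - 1 - int k" "\<lambda>s. nat (t - 1 - s)"]) (auto simp: nat_add_distrib Suc_nat_eq_nat_zadd1)
  moreover have "(\<Sum>k\<in>{m..<n}. \<kappa> k) \<le> (\<Sum>k. \<kappa> k)"
    by (intro sum_le_suminf summable_\<kappa>) auto
  ultimately have main: "S \<in> borel_measurable (past M \<zeta> (t - int m - 1)) \<and> in_Lp M p S \<and>
      expectation (\<lambda>\<omega>. \<bar>S \<omega>\<bar> ^ p) \<le> (\<Sum>k\<in>{m..<n}. \<kappa> k) * C ^ p"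
    using martingale_sum[where u = v and D = "C ^ p" and t = t' and n = "n - m" and c = c, OF v1 v2 v3] suminf_\<kappa>
    unfolding S t' by simp
  then show "in_Lp M p S" and "Lnorm M p S ^ p \<le> (\<Sum>k\<in>{m..<n}. \<kappa> k) * C ^ p"
    by (simp_all add: Lnorm_power[OF p_ge_1])
  show "S \<in> borel_measurable (past M \<zeta> (t - 1))"
    by (rule measurable_past_mono[OF _ conjunct1[OF main]]) simp
qed

lemma series_Lnorm_le:
  assumes u: "\<And>s. u s \<in> borel_measurable (past M \<zeta> (s - 1))" "\<And>s. in_Lp M p (u s)"
      "\<And>s. Lnorm M p (u s) \<le> V * C" and C: "0 \<le> C"
  shows "Lnorm M p (series u t n) \<le> ratio * C"
proof (rule power_le_imp_le_base)
  have "Lnorm M p (series u t n) ^ p \<le> (\<Sum>k\<in>{0..<n}. \<kappa> k) * C ^ p"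
    using series_block(2)[OF u, of 0 n t] by simp
  also have "\<dots> \<le> (\<Sum>k. \<kappa> k) * C ^ p"
    using C by (intro mult_right_mono sum_le_suminf summable_\<kappa>) auto
  also have "\<dots> = (ratio * C) ^ Suc (p - 1)"
    using ratio(3) p_ge_1 by (simp add: power_mult_distrib del: power_Suc)
  finally show "Lnorm M p (series u t n) ^ Suc (p - 1) \<le> (ratio * C) ^ Suc (p - 1)"
    using p_ge_1 by (simp del: power_Suc)
qed (use C ratio in auto)

text \<open>The difference of two partial sums is a block, whose norm is controlled by a section of
  the convergent series of \<open>\<kappa>\<close>.\<close>

lemma series_Cauchy:
  assumes u: "\<And>s. u s \<in> borel_measurable (past M \<zeta> (s - 1))" "\<And>s. in_Lp M p (u s)"
      "\<And>s. Lnorm M p (u s) \<le> V * C" and e: "e > 0"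
  shows "\<exists>N. \<forall>m\<ge>N. \<forall>n\<ge>N. Lnorm M p (\<lambda>\<omega>. series u t m \<omega> - series u t n \<omega>) < e"
proof -
  have "0 \<le> V * C"
    using order_trans[OF Lnorm_nonneg u(3)] .
  then have C: "0 \<le> C"
    using V_pos by (simp add: zero_le_mult_iff)
  \<comment> \<open>The added 1 avoids a division by zero when \<open>C = 0\<close>.\<close>
  have "e ^ p / (C ^ p + 1) > 0"
    using C e by (simp add: add_nonneg_pos)
  then obtain N where N: "\<And>m n. m \<ge> N \<Longrightarrow> norm (\<Sum>k\<in>{m..<n}. \<kappa> k) < e ^ p / (C ^ p + 1)"
    using summable_\<kappa>[unfolded summable_Cauchy] by meson
  have main: "Lnorm M p (\<lambda>\<omega>. series u t n \<omega> - series u t m \<omega>) < e" if "N \<le> m" "m \<le> n" for m n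
  proof (rule power_less_imp_less_base)
    have "{t - int n..<t} = {t - int n..<t - int m} \<union> {t - int m..<t}"
      using that by auto
    then have "series u t n \<omega> - series u t m \<omega> = (\<Sum>s\<in>{t - int n..<t - int m}. b (nat (t - s)) * \<zeta> s \<omega> * u s \<omega>)" for \<omega>
      by (simp add: sum.union_disjoint)
    then have "Lnorm M p (\<lambda>\<omega>. series u t n \<omega> - series u t m \<omega>) ^ p \<le> (\<Sum>k\<in>{m..<n}. \<kappa> k) * C ^ p"
      using series_block(2)[OF u, of m n t] that by simp
    also have "\<dots> \<le> (\<Sum>k\<in>{m..<n}. \<kappa> k) * (C ^ p + 1)"
      by (intro mult_left_mono sum_nonneg) auto
    also have "\<dots> < e ^ p"
      using N[OF that(1), of n] C by (simp add: pos_less_divide_eq add_nonneg_pos abs_of_nonneg sum_nonneg)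
    finally show "Lnorm M p (\<lambda>\<omega>. series u t n \<omega> - series u t m \<omega>) ^ p < e ^ p" .
  qed (use e in auto)
  show ?thesis
  proof (intro exI[of _ N] allI impI)
    fix m n assume "N \<le> m" "N \<le> n"
    then show "Lnorm M p (\<lambda>\<omega>. series u t m \<omega> - series u t n \<omega>) < e"
      using main[of m n] main[of n m] Lnorm_minus_commute[of M p "series u t m" "series u t n"]
      by (cases "m \<le> n") auto
  qed
qed

section \<open>The volatility as a Lipschitz map on processes\<close>

lemma Q_measurable [measurable]: "Q \<in> borel_measurable borel"
proof (rule borel_measurable_continuous_onI)
  have "Lip-lipschitz_on UNIV Q"
    using Lipschitz Lip_pos by (intro lipschitz_onI) (auto simp: dist_real_def)
  then show "continuous_on UNIV Q"
    by (rule lipschitz_on_continuous_on)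
qed

text \<open>Linear growth: the Lipschitz condition compares \<open>Q (a + x)\<close> with the
  constant \<open>Q a\<close>.\<close>

lemma Q_Lp:
  assumes x: "in_Lp M p x" and le: "Lnorm M p x \<le> B"
  shows "in_Lp M p (\<lambda>\<omega>. Q (a + x \<omega>))" and "Lnorm M p (\<lambda>\<omega>. Q (a + x \<omega>)) \<le> \<bar>Q a\<bar> + Lip * B"
proof -
  have [measurable]: "x \<in> borel_measurable M"
    using x by (simp add: in_Lp_def)
  have mono: "in_Lp M p (\<lambda>\<omega>. Q (a + x \<omega>) - Q a)"
    "Lnorm M p (\<lambda>\<omega>. Q (a + x \<omega>) - Q a) \<le> Lnorm M p (\<lambda>\<omega>. Lip * x \<omega>)"
    using Lipschitz[of "a + x _" a] Lip_pos
    by (auto intro!: Lnorm_mono[OF in_Lp_cmult[OF x, of Lip]] p_ge_1 simp: abs_mult)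
  have eq: "(\<lambda>\<omega>. Q (a + x \<omega>)) = (\<lambda>\<omega>. Q a + (Q (a + x \<omega>) - Q a))"
    by simp
  show "in_Lp M p (\<lambda>\<omega>. Q (a + x \<omega>))"
    by (subst eq) (intro in_Lp_add in_Lp_const mono p_ge_1)
  have "Lnorm M p (\<lambda>\<omega>. Q (a + x \<omega>)) \<le> Lnorm M p (\<lambda>_. Q a) + Lnorm M p (\<lambda>\<omega>. Q (a + x \<omega>) - Q a)"
    by (subst eq) (intro Lnorm_add_le in_Lp_const mono p_ge_1)
  also have "\<dots> \<le> \<bar>Q a\<bar> + Lip * B"
  proof -
    have "Lip * Lnorm M p x \<le> Lip * B"
      using le Lip_pos by (intro mult_left_mono) auto
    then show ?thesis
      using mono(2) Lip_pos unfolding Lnorm_const[OF p_ge_1] Lnorm_cmult[OF p_ge_1] by linarith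
  qed
  finally show "Lnorm M p (\<lambda>\<omega>. Q (a + x \<omega>)) \<le> \<bar>Q a\<bar> + Lip * B" .
qed

lemma square_Lp:
  assumes "in_Lp M p f"
  shows "in_Lp M (p div 2) (\<lambda>\<omega>. (f \<omega>)\<^sup>2)" and "Lnorm M (p div 2) (\<lambda>\<omega>. (f \<omega>)\<^sup>2) = (Lnorm M p f)\<^sup>2"
  using assms in_Lp_power2_iff[of f M "p div 2"] Lnorm_power2[OF half_p(2), of M f]
  by (simp_all add: half_p(1) in_Lp_def)

lemma sqrt_Lp:
  assumes "in_Lp M (p div 2) f"
  shows "in_Lp M p (\<lambda>\<omega>. sqrt (f \<omega>))" and "Lnorm M p (\<lambda>\<omega>. sqrt (f \<omega>)) = sqrt (Lnorm M (p div 2) f)"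
  using assms in_Lp_sqrt_iff[of f M "p div 2"] Lnorm_sqrt[OF half_p(2), of M f]
  by (simp_all add: half_p(1) in_Lp_def)

text \<open>The volatility at time \<open>s\<close> involves \<open>X\<close> up to time
  \<open>s\<close> inclusive, which by predictability uses the noise up to \<open>s - 1\<close>
  only. Hence it is independent of \<open>\<zeta> s\<close>.\<close>

lemma vol2_past:
  assumes "predictable M \<zeta> X"
  shows "vol2 \<gamma> Q a X s \<in> borel_measurable (past M \<zeta> (s - 1))"
proof -
  have "X (s - int l) \<in> borel_measurable (past M \<zeta> (s - 1))" for l
    by (rule measurable_past_mono[of "s - int l - 1"]) (use assms in \<open>auto simp: predictable_def\<close>)
  then have "(\<lambda>\<omega>. Q (a + X (s - int l) \<omega>)) \<in> borel_measurable (past M \<zeta> (s - 1))" for l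
    by (intro measurable_compose[OF _ Q_measurable] borel_measurable_add borel_measurable_const)
  then show ?thesis
    unfolding vol2_def[abs_def]
    by (intro borel_measurable_suminf borel_measurable_times borel_measurable_power borel_measurable_const)
qed

context
  fixes X :: "int \<Rightarrow> 'w \<Rightarrow> real" and B :: real
  assumes X: "\<And>t. in_Lp M p (X t)" and X_le: "\<And>t. Lnorm M p (X t) \<le> B"
begin

lemma Q2_Lp:
  "in_Lp M (p div 2) (\<lambda>\<omega>. (Q (a + X t \<omega>))\<^sup>2)"
  "Lnorm M (p div 2) (\<lambda>\<omega>. (Q (a + X t \<omega>))\<^sup>2) \<le> (\<bar>Q a\<bar> + Lip * B)\<^sup>2"
  using Q_Lp[OF X X_le] by (auto simp: square_Lp intro!: power_mono)

lemma vol2_summable: "AE \<omega> in M. summable (\<lambda>l. \<gamma> ^ l * (Q (a + X (t - int l) \<omega>))\<^sup>2)"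
  by (rule weighted_series(1)[OF \<gamma>_nonneg \<gamma>_less_1 half_p(2) Q2_Lp(1) _ Q2_Lp(2)]) simp

lemma vol2_tendsto_Lp:
  "tendsto_Lp M (p div 2) (\<lambda>n \<omega>. \<Sum>l<n. \<gamma> ^ l * (Q (a + X (t - int l) \<omega>))\<^sup>2) (vol2 \<gamma> Q a X t)"
  unfolding vol2_def[abs_def]
  by (rule weighted_series_tendsto_Lp[OF \<gamma>_nonneg \<gamma>_less_1 half_p(2) Q2_Lp(1) _ Q2_Lp(2)]) simp

lemma vol_Lp: "in_Lp M p (vol X t)"
  using vol2_tendsto_Lp[of t] by (intro sqrt_Lp) (simp add: tendsto_Lp_def)

lemma vol_Lnorm_le: "Lnorm M p (vol X t) \<le> sqrt ((\<bar>Q a\<bar> + Lip * B)\<^sup>2 / (1 - \<gamma>))"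
proof -
  have L: "in_Lp M (p div 2) (vol2 \<gamma> Q a X t)"
    using vol2_tendsto_Lp[of t] by (simp add: tendsto_Lp_def)
  have "Lnorm M (p div 2) (vol2 \<gamma> Q a X t) \<le> (\<bar>Q a\<bar> + Lip * B)\<^sup>2 / (1 - \<gamma>)"
    unfolding vol2_def[abs_def]
    by (rule weighted_series(3)[OF \<gamma>_nonneg \<gamma>_less_1 half_p(2) Q2_Lp(1) _ Q2_Lp(2)]) simp
  then show ?thesis
    unfolding sqrt_Lp(2)[OF L] by simp
qed

end

lemma vol_diff:
  assumes X: "\<And>t. in_Lp M p (X t)" "\<And>t. Lnorm M p (X t) \<le> B"
    and Y: "\<And>t. in_Lp M p (Y t)" "\<And>t. Lnorm M p (Y t) \<le> B'"
    and le: "\<And>t. Lnorm M p (\<lambda>\<omega>. X t \<omega> - Y t \<omega>) \<le> C"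
  shows "Lnorm M p (\<lambda>\<omega>. vol X s \<omega> - vol Y s \<omega>) \<le> V * C"
proof -
  have C: "0 \<le> C"
    using order_trans[OF Lnorm_nonneg le] .
  define d where "d = (\<lambda>l \<omega>. (X (s - int l) \<omega> - Y (s - int l) \<omega>)\<^sup>2)"
  define W where "W = (\<lambda>\<omega>. \<Sum>l. \<gamma> ^ l * d l \<omega>)"
  have D: "in_Lp M p (\<lambda>\<omega>. X t \<omega> - Y t \<omega>)" for t
    by (intro in_Lp_diff X Y p_ge_1)
  have d: "in_Lp M (p div 2) (d l)" "0 \<le> d l \<omega>" "Lnorm M (p div 2) (d l) \<le> C\<^sup>2" for l \<omega>
    unfolding d_def using le by (auto intro!: square_Lp D power_mono simp: square_Lp(2)[OF D])
  note w = weighted_series[OF \<gamma>_nonneg \<gamma>_less_1 half_p(2) d(1,2,3)]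
  have W: "in_Lp M (p div 2) W" "Lnorm M (p div 2) W \<le> C\<^sup>2 / (1 - \<gamma>)"
    using w(2,3) by (simp_all add: W_def)
  have "AE \<omega> in M. \<bar>vol X s \<omega> - vol Y s \<omega>\<bar> \<le> \<bar>Lip * sqrt (W \<omega>)\<bar>"
    using vol2_summable[of X B s, OF X] vol2_summable[of Y B' s, OF Y] w(1)
  proof eventually_elim
    fix \<omega>
    assume sX: "summable (\<lambda>l. \<gamma> ^ l * (Q (a + X (s - int l) \<omega>))\<^sup>2)"
      and sY: "summable (\<lambda>l. \<gamma> ^ l * (Q (a + Y (s - int l) \<omega>))\<^sup>2)"
      and sd: "summable (\<lambda>l. \<gamma> ^ l * d l \<omega>)"
    \<comment> \<open>The factor \<open>sqrt (\<gamma> ^ l)\<close> absorbs the weight, so that the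
      unweighted inequality applies.\<close>
    define x where "x l = sqrt (\<gamma> ^ l) * Q (a + X (s - int l) \<omega>)" for l
    define y where "y l = sqrt (\<gamma> ^ l) * Q (a + Y (s - int l) \<omega>)" for l
    have x: "(x l)\<^sup>2 = \<gamma> ^ l * (Q (a + X (s - int l) \<omega>))\<^sup>2"
      and y: "(y l)\<^sup>2 = \<gamma> ^ l * (Q (a + Y (s - int l) \<omega>))\<^sup>2" for l
      using \<gamma>_nonneg by (simp_all add: x_def y_def power_mult_distrib)
    have "(x l - y l)\<^sup>2 \<le> Lip\<^sup>2 * (\<gamma> ^ l * d l \<omega>)" for l
    proof -
      have "(Q (a + X (s - int l) \<omega>) - Q (a + Y (s - int l) \<omega>))\<^sup>2 \<le> Lip\<^sup>2 * d l \<omega>"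
        using power_mono[OF Lipschitz[of "a + X (s - int l) \<omega>" "a + Y (s - int l) \<omega>"] abs_ge_zero, of 2]
        by (simp add: d_def power_mult_distrib)
      then have "\<gamma> ^ l * (Q (a + X (s - int l) \<omega>) - Q (a + Y (s - int l) \<omega>))\<^sup>2 \<le> \<gamma> ^ l * (Lip\<^sup>2 * d l \<omega>)"
        using \<gamma>_nonneg by (intro mult_left_mono) auto
      moreover have "(x l - y l)\<^sup>2 = \<gamma> ^ l * (Q (a + X (s - int l) \<omega>) - Q (a + Y (s - int l) \<omega>))\<^sup>2"
        using \<gamma>_nonneg by (simp add: x_def y_def power_mult_distrib flip: right_diff_distrib)
      ultimately show ?thesis by (simp add: mult_ac)
    qed
    then have "\<bar>vol X s \<omega> - vol Y s \<omega>\<bar> \<le> sqrt (\<Sum>l. Lip\<^sup>2 * (\<gamma> ^ l * d l \<omega>))"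
      using sqrt_suminf_diff_le[of x y "\<lambda>l. Lip\<^sup>2 * (\<gamma> ^ l * d l \<omega>)"] sX sY summable_mult[OF sd, of "Lip\<^sup>2"]
      unfolding x y vol2_def by simp
    also have "\<dots> = Lip * sqrt (W \<omega>)"
      using Lip_pos by (simp add: suminf_mult[OF sd] W_def real_sqrt_mult)
    finally show "\<bar>vol X s \<omega> - vol Y s \<omega>\<bar> \<le> \<bar>Lip * sqrt (W \<omega>)\<bar>"
      by linarith
  qed
  moreover have "in_Lp M p (\<lambda>\<omega>. vol X s \<omega> - vol Y s \<omega>)"
    using vol_Lp[of X B s, OF X] vol_Lp[of Y B' s, OF Y] p_ge_1 by (rule in_Lp_diff)
  ultimately have "Lnorm M p (\<lambda>\<omega>. vol X s \<omega> - vol Y s \<omega>) \<le> Lnorm M p (\<lambda>\<omega>. Lip * sqrt (W \<omega>))"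
    using in_Lp_cmult[OF sqrt_Lp(1)[OF W(1)]] p_ge_1 by (intro Lnorm_mono(2)) (auto simp: in_Lp_def)
  also have "\<dots> = Lip * sqrt (Lnorm M (p div 2) W)"
    using Lip_pos by (simp add: Lnorm_cmult[OF p_ge_1] sqrt_Lp(2)[OF W(1)])
  also have "\<dots> \<le> Lip * sqrt (C\<^sup>2 / (1 - \<gamma>))"
    using W(2) Lip_pos by (intro mult_left_mono) auto
  also have "\<dots> = V * C"
    using C by (simp add: V_def real_sqrt_divide)
  finally show ?thesis .
qed

text \<open>By linearity, the difference of the partial sums is the series driven by the difference
  of the volatilities. With arbitrary limits \<open>X'\<close> and \<open>Y'\<close> the statement
  covers both the iteration and two actual solutions.\<close>

lemma contraction:
  assumes X: "predictable M \<zeta> X" "\<And>t. in_Lp M p (X t)" "\<And>t. Lnorm M p (X t) \<le> B"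
    and Y: "predictable M \<zeta> Y" "\<And>t. in_Lp M p (Y t)" "\<And>t. Lnorm M p (Y t) \<le> B'"
    and le: "\<And>t. Lnorm M p (\<lambda>\<omega>. X t \<omega> - Y t \<omega>) \<le> C"
    and X': "tendsto_Lp M p (series (vol X) t) X'" and Y': "tendsto_Lp M p (series (vol Y) t) Y'"
  shows "Lnorm M p (\<lambda>\<omega>. X' \<omega> - Y' \<omega>) \<le> ratio * C"
proof -
  have C: "0 \<le> C"
    using order_trans[OF Lnorm_nonneg le] .
  define u where "u = (\<lambda>s \<omega>. vol X s \<omega> - vol Y s \<omega>)"
  have u1: "u s \<in> borel_measurable (past M \<zeta> (s - 1))" for s
    unfolding u_def
    by (intro borel_measurable_diff borel_measurable_sqrt[THEN measurable_compose[rotated]] vol2_past X Y)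
  have u2: "in_Lp M p (u s)" for s
    unfolding u_def using vol_Lp[of X B s, OF X(2,3)] vol_Lp[of Y B' s, OF Y(2,3)] p_ge_1 by (rule in_Lp_diff)
  have u3: "Lnorm M p (u s) \<le> V * C" for s
    unfolding u_def by (rule vol_diff[OF X(2,3) Y(2,3) le])
  have "(\<lambda>n \<omega>. series (vol X) t n \<omega> - series (vol Y) t n \<omega>) = series u t"
    by (intro ext) (simp add: u_def right_diff_distrib sum_subtractf)
  then have "tendsto_Lp M p (series u t) (\<lambda>\<omega>. X' \<omega> - Y' \<omega>)"
    using tendsto_Lp_diff[OF X' Y' p_ge_1] by simp
  then show ?thesis
    by (rule tendsto_Lp_Lnorm_le[OF _ p_ge_1]) (rule series_Lnorm_le[OF u1 u2 u3 C])
qed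

end

subsection \<open>Causal functionals of the noise\<close>

lemma measurable_PiM_reindex:
  assumes "\<And>k. f k \<in> borel_measurable N"
  shows "(\<lambda>\<omega> k. f k \<omega>) \<in> measurable N (\<Pi>\<^sub>M k\<in>UNIV. borel)"
  by (rule measurable_PiM_single') (use assms in auto)

context iid_noise
begin

abbreviation seq_space :: "(nat \<Rightarrow> real) measure" where
  "seq_space \<equiv> \<Pi>\<^sub>M k\<in>UNIV. borel"

text \<open>The noise strictly before time \<open>t\<close>, most recent value first.\<close>

definition lag :: "int \<Rightarrow> 'w \<Rightarrow> nat \<Rightarrow> real" where
  "lag t = (\<lambda>\<omega> k. \<zeta> (t - 1 - int k) \<omega>)"

text \<open>The law of the past seen from any time, by \<open>lag_distr\<close>. For processes
  \<open>g (lag t)\<close> the norm uniform in time becomes the single norm of \<open>g\<close>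
  under this law.\<close>

definition \<nu> :: "(nat \<Rightarrow> real) measure" where
  "\<nu> = distr M seq_space (lag 0)"

text \<open>The whole noise has a product law, and an injective choice of coordinates of a product
  of identical factors is again such a product. Reversed times give the law of \<open>lag t\<close>,
  shifted times give stationarity.\<close>

lemma noise_law:
  fixes f :: "'k \<Rightarrow> int"
  assumes "inj f"
  shows "distr M (\<Pi>\<^sub>M k\<in>UNIV. borel) (\<lambda>\<omega> k. \<zeta> (f k) \<omega>) = (\<Pi>\<^sub>M k\<in>UNIV. distr M borel (\<zeta> 0))"
proof -
  let ?\<mu> = "distr M borel (\<zeta> 0)"
  interpret \<mu>: prob_space ?\<mu>
    by (rule prob_space_distr) simp
  have sets: "sets (\<Pi>\<^sub>M k\<in>UNIV. ?\<mu>) = sets (\<Pi>\<^sub>M k\<in>(UNIV :: 'k set). borel)"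
    by (rule sets_PiM_cong) auto
  have "distr M (\<Pi>\<^sub>M s\<in>UNIV. borel) (\<lambda>\<omega> s. \<zeta> s \<omega>) = (\<Pi>\<^sub>M s\<in>UNIV. distr M borel (\<zeta> s))"
    using indep_vars_iff_distr_eq_PiM[of UNIV \<zeta> "\<lambda>_. borel"] iid by (simp add: iid_def restrict_UNIV)
  also have "\<dots> = (\<Pi>\<^sub>M s\<in>UNIV. ?\<mu>)"
    by (intro PiM_cong refl noise_distr)
  finally have 1: "distr M (\<Pi>\<^sub>M s\<in>UNIV. borel) (\<lambda>\<omega> s. \<zeta> s \<omega>) = (\<Pi>\<^sub>M s\<in>UNIV. ?\<mu>)" .
  have 2: "distr (\<Pi>\<^sub>M s\<in>UNIV. ?\<mu>) (\<Pi>\<^sub>M k\<in>UNIV. ?\<mu>) (\<lambda>z k. z (f k)) = (\<Pi>\<^sub>M k\<in>(UNIV :: 'k set). ?\<mu>)"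
    using distr_PiM_reindex[of UNIV "\<lambda>_. ?\<mu>" f UNIV] assms \<mu>.prob_space_axioms
    by (simp add: restrict_UNIV)
  have "distr M (\<Pi>\<^sub>M k\<in>UNIV. borel) (\<lambda>\<omega> k. \<zeta> (f k) \<omega>)
      = distr (distr M (\<Pi>\<^sub>M s\<in>UNIV. borel) (\<lambda>\<omega> s. \<zeta> s \<omega>)) (\<Pi>\<^sub>M k\<in>UNIV. borel) (\<lambda>z k. z (f k))"
    by (subst distr_distr) (auto simp: comp_def intro!: measurable_PiM_reindex)
  also have "\<dots> = distr (\<Pi>\<^sub>M s\<in>UNIV. ?\<mu>) (\<Pi>\<^sub>M k\<in>UNIV. ?\<mu>) (\<lambda>z k. z (f k))"
    unfolding 1 by (rule distr_cong) (auto simp: sets)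
  finally show ?thesis
    unfolding 2 .
qed

lemma lag_measurable_past: "lag t \<in> measurable (past M \<zeta> (t - 1)) seq_space"
  unfolding lag_def by (intro measurable_PiM_reindex noise_measurable_past) simp

lemma lag_measurable [measurable]: "lag t \<in> measurable M seq_space"
  unfolding lag_def by (intro measurable_PiM_reindex noise_measurable)

lemma lag_distr: "distr M seq_space (lag t) = \<nu>"
proof -
  have inj: "inj (\<lambda>k. t - 1 - int k)" for t :: int
    by (rule injI) simp
  show ?thesis
    unfolding \<nu>_def lag_def noise_law[OF inj] ..
qed

lemma prob_space_\<nu>: "prob_space \<nu>"
  unfolding \<nu>_def by (rule prob_space_distr) measurable

lemma functional_in_Lp: "in_Lp \<nu> p g \<Longrightarrow> in_Lp M p (\<lambda>\<omega>. g (lag t \<omega>))"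
  and functional_Lnorm: "in_Lp \<nu> p g \<Longrightarrow> Lnorm M p (\<lambda>\<omega>. g (lag t \<omega>)) = Lnorm \<nu> p g"
  and functional_predictable: "in_Lp \<nu> p g \<Longrightarrow> predictable M \<zeta> (\<lambda>t \<omega>. g (lag t \<omega>))"
proof -
  assume g: "in_Lp \<nu> p g"
  then have m: "g \<in> borel_measurable seq_space"
    by (simp add: in_Lp_def \<nu>_def)
  show "in_Lp M p (\<lambda>\<omega>. g (lag t \<omega>))" "Lnorm M p (\<lambda>\<omega>. g (lag t \<omega>)) = Lnorm \<nu> p g"
    using in_Lp_distr_iff[OF lag_measurable m, of t p] Lnorm_distr[OF lag_measurable m, of t p] g
    by (simp_all add: lag_distr)
  show "predictable M \<zeta> (\<lambda>t \<omega>. g (lag t \<omega>))"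
    unfolding predictable_def by (intro allI measurable_compose[OF lag_measurable_past m])
qed

text \<open>The vector at the times shifted by \<open>h\<close> is the fixed map \<open>H I\<close>
  applied to the shifted noise \<open>R h\<close>, whose law does not depend on
  \<open>h\<close>.\<close>

lemma functional_stationary:
  assumes "in_Lp \<nu> p g"
  shows "stationary M (\<lambda>t \<omega>. g (lag t \<omega>))"
proof -
  have m: "g \<in> borel_measurable seq_space"
    using assms by (simp add: in_Lp_def \<nu>_def)
  define R where "R h = (\<lambda>\<omega> s. \<zeta> (s + h) \<omega>)" for h :: int
  define H where "H I z = (\<lambda>i\<in>I. g (\<lambda>k. z (i - 1 - int k)))" for I and z :: "int \<Rightarrow> real"
  have R: "R h \<in> measurable M (\<Pi>\<^sub>M s\<in>UNIV. borel)" for h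
    unfolding R_def by (intro measurable_PiM_reindex noise_measurable)
  have H: "H I \<in> measurable (\<Pi>\<^sub>M s\<in>UNIV. borel) (\<Pi>\<^sub>M i\<in>I. borel)" for I
    unfolding H_def[abs_def]
    by (intro measurable_restrict measurable_compose[OF _ m] measurable_PiM_reindex) simp
  have law: "distr M (\<Pi>\<^sub>M s\<in>UNIV. borel) (R h) = (\<Pi>\<^sub>M s\<in>UNIV. distr M borel (\<zeta> 0))" for h
    unfolding R_def by (rule noise_law) (simp add: inj_def)
  have "distr M (\<Pi>\<^sub>M i\<in>I. borel) (\<lambda>\<omega>. \<lambda>i\<in>I. g (lag (i + h) \<omega>))
      = distr (\<Pi>\<^sub>M s\<in>UNIV. distr M borel (\<zeta> 0)) (\<Pi>\<^sub>M i\<in>I. borel) (H I)" for I h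
  proof -
    have "(\<lambda>\<omega>. \<lambda>i\<in>I. g (lag (i + h) \<omega>)) = H I \<circ> R h"
      by (auto simp: H_def R_def lag_def fun_eq_iff algebra_simps)
    then show ?thesis
      by (simp add: distr_distr[OF H R, symmetric] law)
  qed
  from this this[of _ 0] show ?thesis
    using functional_in_Lp[OF assms] by (simp add: stationary_def in_Lp_def)
qed

end

subsection \<open>Existence and uniqueness\<close>

context vol_model
begin

text \<open>Causality with the same functional at every time: volatilities and partial sums read
  only the past of \<open>t\<close>, so the iteration stays among causal functionals.\<close>

lemma series_functional:
  assumes "in_Lp \<nu> p g"
  obtains F where "\<And>n. F n \<in> borel_measurable seq_space"
    "\<And>t n \<omega>. series (vol (\<lambda>t \<omega>. g (lag t \<omega>))) t n \<omega> = F n (lag t \<omega>)"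
proof
  have m: "g \<in> borel_measurable seq_space"
    using assms by (simp add: in_Lp_def \<nu>_def)
  \<comment> \<open>At time \<open>s = t - 1 - k\<close>, the sequence
    \<open>lag (s - int l)\<close> is \<open>lag t\<close> with its first \<open>k + 1 + l\<close>
    entries dropped.\<close>
  define v where "v k w = (\<Sum>l. \<gamma> ^ l * (Q (a + g (\<lambda>j. w (k + 1 + l + j))))\<^sup>2)" for k and w :: "nat \<Rightarrow> real"
  define F where "F n w = (\<Sum>k<n. b (Suc k) * w k * sqrt (v k w))" for n w
  have "(\<lambda>w. g (\<lambda>j. w (i + j))) \<in> borel_measurable seq_space" for i
    by (intro measurable_compose[OF _ m] measurable_PiM_reindex) simp
  then have [measurable]: "v k \<in> borel_measurable seq_space" for k
    unfolding v_def[abs_def] by measurable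
  show "F n \<in> borel_measurable seq_space" for n
    unfolding F_def[abs_def] by measurable
  show "series (vol (\<lambda>t \<omega>. g (lag t \<omega>))) t n \<omega> = F n (lag t \<omega>)" for t n \<omega>
    unfolding F_def
  proof (rule sum.reindex_bij_witness[of _ "\<lambda>k. t - 1 - int k" "\<lambda>s. nat (t - 1 - s)"])
    fix s assume s: "s \<in> {t - int n..<t}"
    define k where "k = nat (t - 1 - s)"
    have s_eq: "s = t - 1 - int k" and k: "nat (t - s) = Suc k"
      using s by (auto simp: k_def)
    have "lag (s - int l) \<omega> = (\<lambda>j. lag t \<omega> (k + 1 + l + j))" for l
      by (simp add: lag_def s_eq algebra_simps)
    then have "vol2 \<gamma> Q a (\<lambda>t \<omega>. g (lag t \<omega>)) s \<omega> = v k (lag t \<omega>)"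
      by (simp add: vol2_def v_def)
    moreover have "lag t \<omega> k = \<zeta> s \<omega>"
      by (simp add: lag_def s_eq)
    ultimately show "b (Suc (nat (t - 1 - s))) * lag t \<omega> (nat (t - 1 - s)) * sqrt (v (nat (t - 1 - s)) (lag t \<omega>)) =
        b (nat (t - s)) * \<zeta> s \<omega> * vol (\<lambda>t \<omega>. g (lag t \<omega>)) s \<omega>"
      by (simp add: k flip: k_def)
  qed auto
qed

lemma vol_past:
  assumes "predictable M \<zeta> X"
  shows "vol X s \<in> borel_measurable (past M \<zeta> (s - 1))"
  by (rule measurable_compose[OF vol2_past[OF assms] borel_measurable_sqrt])

text \<open>The Cauchy property, proved at time 0, is transferred to \<open>\<nu>\<close> and
  completeness is used there. The limit is thus an exact function of \<open>lag t\<close>, hence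
  predictable although the past sigma-algebras are not completed.\<close>

lemma series_functional_converges:
  assumes g: "in_Lp \<nu> p g"
  obtains h where "in_Lp \<nu> p h"
    "\<And>t. tendsto_Lp M p (series (vol (\<lambda>t \<omega>. g (lag t \<omega>))) t) (\<lambda>\<omega>. h (lag t \<omega>))"
proof -
  interpret \<nu>: prob_space \<nu> by (rule prob_space_\<nu>)
  define X where "X = (\<lambda>t \<omega>. g (lag t \<omega>))"
  obtain F where F: "\<And>n. F n \<in> borel_measurable seq_space" "\<And>t n \<omega>. series (vol X) t n \<omega> = F n (lag t \<omega>)"
    by (rule series_functional[OF g, folded X_def]) (rule that)
  have Xp: "predictable M \<zeta> X" and XL: "in_Lp M p (X t)" and X_le: "Lnorm M p (X t) \<le> Lnorm \<nu> p g" for t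
    unfolding X_def using functional_predictable[OF g] functional_in_Lp[OF g] functional_Lnorm[OF g] by auto
  \<comment> \<open>Division by \<open>V\<close> brings the volatility bound into the form
    \<open>V * C\<close>.\<close>
  define C where "C = sqrt ((\<bar>Q a\<bar> + Lip * Lnorm \<nu> p g)\<^sup>2 / (1 - \<gamma>)) / V"
  have u: "vol X s \<in> borel_measurable (past M \<zeta> (s - 1))" "in_Lp M p (vol X s)" "Lnorm M p (vol X s) \<le> V * C" for s
    using vol_past[OF Xp] vol_Lp[OF XL X_le] vol_Lnorm_le[OF XL X_le] V_pos by (auto simp: C_def)
  have S: "series (vol X) t n = (\<lambda>\<omega>. F n (lag t \<omega>))" for t n
    using F(2) by auto
  have L: "in_Lp \<nu> p (F n)" for n
    using series_block(1)[OF u, of 0 n 0] in_Lp_distr_iff[OF lag_measurable F(1), of 0 p n] S[of 0 n]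
    by (simp add: lag_distr)
  have "Lnorm \<nu> p (\<lambda>w. F m w - F n w) = Lnorm M p (\<lambda>\<omega>. series (vol X) 0 m \<omega> - series (vol X) 0 n \<omega>)" for m n
    using Lnorm_distr[OF lag_measurable, of "\<lambda>w. F m w - F n w" 0 p] F(1) unfolding F(2) lag_distr by simp
  then have "\<exists>N. \<forall>m\<ge>N. \<forall>n\<ge>N. Lnorm \<nu> p (\<lambda>w. F m w - F n w) < e" if "e > 0" for e
    using series_Cauchy[OF u that, of 0] by simp
  from \<nu>.Lp_complete[OF p_ge_1 L this] obtain h where h: "tendsto_Lp \<nu> p F h" .
  show ?thesis
  proof
    show "in_Lp \<nu> p h"
      using h by (simp add: tendsto_Lp_def)
    show "tendsto_Lp M p (series (vol (\<lambda>t \<omega>. g (lag t \<omega>))) t) (\<lambda>\<omega>. h (lag t \<omega>))" for t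
      unfolding X_def[symmetric] S by (rule tendsto_Lp_distr[OF lag_measurable]) (simp add: lag_distr h)
  qed
qed

text \<open>A fixed point of the induced map on functionals gives a solution. Its equation holds
  almost everywhere under \<open>\<nu>\<close>, the law of every \<open>lag t\<close>, so it
  transfers to all times at once.\<close>

lemma exists_solution:
  obtains X where "Lp_solution M \<zeta> p \<gamma> Q a b X" "stationary M X"
proof -
  interpret \<nu>: prob_space \<nu> by (rule prob_space_\<nu>)
  define step where "step g h \<longleftrightarrow> in_Lp \<nu> p h \<and>
    (\<forall>t. tendsto_Lp M p (series (vol (\<lambda>t \<omega>. g (lag t \<omega>))) t) (\<lambda>\<omega>. h (lag t \<omega>)))" for g h
  \<comment> \<open>An \<open>L\<^sup>p\<close> limit is determined only almost everywhere; the
    choice operator picks one version.\<close>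
  define T where "T g = (SOME h. step g h)" for g
  have step_T: "step g (T g)" if g: "in_Lp \<nu> p g" for g
  proof -
    obtain h where "in_Lp \<nu> p h"
      "\<And>t. tendsto_Lp M p (series (vol (\<lambda>t \<omega>. g (lag t \<omega>))) t) (\<lambda>\<omega>. h (lag t \<omega>))"
      by (rule series_functional_converges[OF g]) (rule that)
    then have "step g h"
      unfolding step_def by (intro conjI allI)
    then show ?thesis
      unfolding T_def by (rule someI[of "step g"])
  qed
  have T: "in_Lp \<nu> p (T g)"
    "tendsto_Lp M p (series (vol (\<lambda>t \<omega>. g (lag t \<omega>))) t) (\<lambda>\<omega>. T g (lag t \<omega>))"
    if "in_Lp \<nu> p g" for g t
    using step_T[OF that] unfolding step_def by blast+
  have contr: "Lnorm \<nu> p (\<lambda>w. T f w - T g w) \<le> ratio * Lnorm \<nu> p (\<lambda>w. f w - g w)"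
    if f: "in_Lp \<nu> p f" and g: "in_Lp \<nu> p g" for f g
  proof -
    \<comment> \<open>Time 0 suffices, since norms of functionals are the same at all times.\<close>
    have "Lnorm M p (\<lambda>\<omega>. T f (lag 0 \<omega>) - T g (lag 0 \<omega>)) \<le> ratio * Lnorm \<nu> p (\<lambda>w. f w - g w)"
      using functional_predictable[OF f] functional_in_Lp[OF f] functional_Lnorm[OF f, THEN eq_refl]
        functional_predictable[OF g] functional_in_Lp[OF g] functional_Lnorm[OF g, THEN eq_refl]
        functional_Lnorm[OF in_Lp_diff[OF f g p_ge_1], THEN eq_refl] T(2)[OF f] T(2)[OF g]
      by (rule contraction)
    then show ?thesis
      using functional_Lnorm[OF in_Lp_diff[OF T(1)[OF f] T(1)[OF g] p_ge_1], of 0] by simp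
  qed
  obtain g where g: "in_Lp \<nu> p g" and fix_g: "AE w in \<nu>. T g w = g w"
    by (rule \<nu>.Lp_contraction_fixpoint[OF p_ge_1 ratio(1,2) T(1) contr]) (assumption | rule that)+
  define X where "X = (\<lambda>t \<omega>. g (lag t \<omega>))"
  have X: "predictable M \<zeta> X" "in_Lp M p (X t)" "Lnorm M p (X t) \<le> Lnorm \<nu> p g" for t
    unfolding X_def using functional_predictable[OF g] functional_in_Lp[OF g] functional_Lnorm[OF g] by auto
  have "tendsto_Lp M p (series (vol X) t) (X t)" for t
  proof (rule tendsto_Lp_cong_AE)
    show "tendsto_Lp M p (series (vol X) t) (\<lambda>\<omega>. T g (lag t \<omega>))"
      unfolding X_def by (rule T(2)[OF g])
    have "AE w in distr M seq_space (lag t). T g w = g w"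
      unfolding lag_distr by (rule fix_g)
    then show "AE \<omega> in M. T g (lag t \<omega>) = X t \<omega>"
      unfolding X_def by (rule AE_distrD[OF lag_measurable])
    show "X t \<in> borel_measurable M"
      using X(2) by (simp add: in_Lp_def)
  qed
  then have "Lp_solution M \<zeta> p \<gamma> Q a b X"
    unfolding Lp_solution_def using X vol2_tendsto_Lp[OF X(2,3)] by (auto simp: in_Lp_def)
  moreover have "stationary M X"
    unfolding X_def by (rule functional_stationary[OF g])
  ultimately show ?thesis ..
qed

text \<open>The one-dimensional case of stationarity; it supplies the bound uniform in time that the
  contraction needs.\<close>

lemma stationary_Lnorm:
  assumes "stationary M X"
  shows "Lnorm M q (X t) = Lnorm M q (X 0)"
proof -
  have X [measurable]: "X t \<in> borel_measurable M" for t
    using assms by (simp add: stationary_def)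
  have comp: "distr M borel (X t) = distr (distr M (\<Pi>\<^sub>M i\<in>{0}. borel) (\<lambda>\<omega>. \<lambda>i\<in>{0}. X (i + t) \<omega>)) borel (\<lambda>z. z 0)" for t
    by (subst distr_distr) (auto simp: comp_def)
  have "distr M (\<Pi>\<^sub>M i\<in>{0}. borel) (\<lambda>\<omega>. \<lambda>i\<in>{0}. X (i + t) \<omega>) = distr M (\<Pi>\<^sub>M i\<in>{0}. borel) (\<lambda>\<omega>. \<lambda>i\<in>{0}. X (i + 0) \<omega>)"
    using assms[unfolded stationary_def, THEN conjunct2, rule_format, of "{0}" t] by simp
  then have "distr M borel (X t) = distr M borel (X 0)"
    using comp[of t] comp[of 0] by simp
  then show ?thesis
    using Lnorm_distr[OF X, of "\<lambda>x. x" t q] Lnorm_distr[OF X, of "\<lambda>x. x" 0 q] by simp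
qed

text \<open>Each solution reproduces itself under the map, so the contraction can be repeated, and
  its factors tend to 0. The induction treats all times together because a bound at one time rests
  on bounds at all earlier ones.\<close>

lemma solution_unique:
  assumes X: "Lp_solution M \<zeta> p \<gamma> Q a b X" "stationary M X"
    and Y: "Lp_solution M \<zeta> p \<gamma> Q a b Y" "stationary M Y"
  shows "AE \<omega> in M. Y t \<omega> = X t \<omega>"
proof -
  have L: "in_Lp M p (Z t)" and le: "Lnorm M p (Z t) \<le> Lnorm M p (Z 0)"
    and pred: "predictable M \<zeta> Z" and lim: "tendsto_Lp M p (series (vol Z) t) (Z t)"
    if "Lp_solution M \<zeta> p \<gamma> Q a b Z" "stationary M Z" for Z t
    using that stationary_Lnorm[OF that(2), of p t] by (auto simp: Lp_solution_def in_Lp_def stationary_def)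
  define C where "C = Lnorm M p (Y 0) + Lnorm M p (X 0)"
  have bound: "Lnorm M p (\<lambda>\<omega>. Y t \<omega> - X t \<omega>) \<le> ratio ^ n * C" for n t
  proof (induction n arbitrary: t)
    case 0
    have "Lnorm M p (\<lambda>\<omega>. Y t \<omega> + - X t \<omega>) \<le> Lnorm M p (Y t) + Lnorm M p (\<lambda>\<omega>. - X t \<omega>)"
      by (intro Lnorm_add_le in_Lp_uminus L[OF X] L[OF Y] p_ge_1)
    then show ?case
      using le[OF X, of t] le[OF Y, of t] by (simp add: C_def Lnorm_uminus)
  next
    case (Suc n)
    have "Lnorm M p (\<lambda>\<omega>. Y t \<omega> - X t \<omega>) \<le> ratio * (ratio ^ n * C)"
      by (rule contraction[OF pred[OF Y] L[OF Y] le[OF Y] pred[OF X] L[OF X] le[OF X] Suc lim[OF Y] lim[OF X]])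
    then show ?case by (simp add: mult.assoc)
  qed
  have "(\<lambda>n. ratio ^ n * C) \<longlonglongrightarrow> 0"
    using ratio by (intro tendsto_mult_left_zero LIMSEQ_realpow_zero) auto
  then have "Lnorm M p (\<lambda>\<omega>. Y t \<omega> - X t \<omega>) \<le> 0"
    using bound by (intro LIMSEQ_le_const) auto
  then have "Lnorm M p (\<lambda>\<omega>. Y t \<omega> - X t \<omega>) = 0"
    using Lnorm_nonneg[of M p "\<lambda>\<omega>. Y t \<omega> - X t \<omega>"] by simp
  then have "AE \<omega> in M. Y t \<omega> - X t \<omega> = 0"
    by (rule Lnorm_eq_0_imp_AE[OF in_Lp_diff[OF L[OF Y] L[OF X] p_ge_1] p_ge_1])
  then show ?thesis by auto
qed

end

theorem theorem5:
  fixes M :: "'w measure" and \<zeta> :: "int \<Rightarrow> 'w \<Rightarrow> real"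
    and \<gamma> a Lip :: real and b :: "nat \<Rightarrow> real" and Q :: "real \<Rightarrow> real" and p :: nat
  assumes "prob_space M"
    and "0 \<le> \<gamma>" and "\<gamma> < 1"
    and "Lip > 0" and "\<And>x y. \<bar>Q x - Q y\<bar> \<le> Lip * \<bar>x - y\<bar>"
    and "even p" and "p \<ge> 2"
    and "iid M \<zeta>"
    and "integrable M (\<lambda>\<omega>. \<bar>\<zeta> 0 \<omega>\<bar> ^ p)"
    and "(\<integral>\<omega>. \<zeta> 0 \<omega> \<partial>M) = 0"
    and "(\<Sum>j=2..p. ennreal (real (p choose j) * \<bar>\<integral>\<omega>. \<zeta> 0 \<omega> ^ j \<partial>M\<bar> * Lip ^ j)
            * (\<Sum>k. ennreal (\<bar>b (Suc k)\<bar> ^ j)))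
         < ennreal ((1 - \<gamma>) ^ (p div 2))"
  shows "\<exists>X. Lp_solution M \<zeta> p \<gamma> Q a b X \<and> stationary M X \<and>
           (\<forall>Y. Lp_solution M \<zeta> p \<gamma> Q a b Y \<and> stationary M Y \<longrightarrow>
                (\<forall>t. AE \<omega> in M. Y t \<omega> = X t \<omega>))"
proof -
  interpret vol_model M \<zeta> p \<gamma> a Lip b Q
    by (intro vol_model.intro vol_model_axioms.intro iid_noise.intro iid_noise_axioms.intro; fact assms)
  obtain X where X: "Lp_solution M \<zeta> p \<gamma> Q a b X" "stationary M X"
    by (rule exists_solution) (rule that)
  show ?thesis
    by (intro exI[of _ X] conjI allI impI X) (blast intro: solution_unique[OF X])
qed

end
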